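(* Let $G$ be a finite group with a non-trivial normal abelian subgroup $A$ and let $\rho\colon G\to\mathrm{GL}(n,\mathbb{Z})$ be a faithful $\mathbb{R}$-irreducible representation. Suppose $n$ is odd. Then for every $D\in N_{\mathrm{GL}(n,\mathbb{Z})}(\rho(G))$ there exists $g\in G$ such that $\rho(g)D$ has eigenvalue $1$.
   Context: $N_{\mathrm{GL}(n,\mathbb{Z})}(\rho(G))$ denotes the normalizer of $\rho(G)$ in $\mathrm{GL}(n,\mathbb{Z})$. A representation over $\mathbb{Z}$ is $\mathbb{R}$-irreducible if it is irreducible when viewed as a representation on $\mathbb{R}^n$. *)

theory Defs
  imports
    "HOL-Algebra.Group_Action"
    "Jordan_Normal_Form.Char_Poly"
    "Jordan_Normal_Form.VS_Connect"
begin

definition GL_int :: "nat \<Rightarrow> int mat monoid" where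
  "GL_int n = units_of (ring_mat TYPE(int) n ())"

definition invariant_subspace ::
    "('g, 'x) monoid_scheme \<Rightarrow> nat \<Rightarrow> ('g \<Rightarrow> real mat) \<Rightarrow> real vec set \<Rightarrow> bool" where
  "invariant_subspace G n \<sigma> W \<longleftrightarrow>
     VectorSpace.subspace class_ring W (module_vec TYPE(real) n) \<and>
     (\<forall>g \<in> carrier G. \<forall>w \<in> W. \<sigma> g *\<^sub>v w \<in> W)"

text \<open>The condition \<^term>\<open>0 < n\<close> is the usual convention that the zero representation is not
  irreducible.\<close>

definition irreducible_rep ::
    "('g, 'x) monoid_scheme \<Rightarrow> nat \<Rightarrow> ('g \<Rightarrow> real mat) \<Rightarrow> bool" where
  "irreducible_rep G n \<sigma> \<longleftrightarrow> 0 < n \<and>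
     (\<forall>W. invariant_subspace G n \<sigma> W \<longrightarrow> W = {0\<^sub>v n} \<or> W = carrier_vec n)"

abbreviation real_mat :: "int mat \<Rightarrow> real mat" where
  "real_mat \<equiv> map_mat real_of_int"

definition R_irreducible ::
    "('g, 'x) monoid_scheme \<Rightarrow> nat \<Rightarrow> ('g \<Rightarrow> int mat) \<Rightarrow> bool" where
  "R_irreducible G n \<rho> \<longleftrightarrow> irreducible_rep G n (\<lambda>g. real_mat (\<rho> g))"

end

theory Submission
  imports Defs
begin

text \<open>
Let \<open>\<Gamma>\<close> be the finite group \<open>\<rho>(G)\<close>, viewed as a group of real matrices. The proof studies normal
subgroups \<open>E\<close> of \<open>\<Gamma>\<close> all of whose elements satisfy \<open>a\<^sup>2 = 1\<close>. Such an \<open>E\<close> is diagonalizable, and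
the space is the direct sum of its isotypic components, the non-zero common eigenspaces belonging to
characters \<open>E \<rightarrow> {1, -1}\<close>. By irreducibility \<open>\<Gamma>\<close> permutes these components transitively, so they
have a common dimension \<open>d\<close>. This \<open>d\<close> divides \<open>n\<close> and is therefore odd.

Suppose that \<open>D\<close> normalizes both \<open>\<Gamma>\<close> and some non-trivial \<open>E\<close>, and choose \<open>c \<in> E\<close> with \<open>c \<noteq> 1\<close> and a
component on which \<open>c\<close> is \<open>-1\<close>. Then \<open>D\<close> permutes the components too, and by transitivity some
\<open>M = g D\<close> with \<open>g \<in> \<Gamma>\<close> maps the chosen component to itself. Its dimension is odd, so \<open>M\<close> has a
real eigenvector in it. The eigenvalue is \<open>1\<close> or \<open>-1\<close>: a power of \<open>M\<close> centralizes the finite group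
\<open>\<Gamma>\<close>, is a scalar by Schur's lemma (the dimension is odd), and has determinant \<open>1\<close> or \<open>-1\<close>. If the
eigenvalue is \<open>-1\<close>, then \<open>c M = (c g) D\<close> fixes the eigenvector
(\<open>odd_rank_isotypic_component\<close>, \<open>coset_has_fixed_vector\<close>).

It remains to find an \<open>E\<close> that \<open>D\<close> normalizes. First, the given abelian normal subgroup contains an
involution (\<open>normal_subgroup_has_involution\<close>): the sum of the matrices in a non-trivial normal
subgroup is zero, and the traces of \<open>a\<close> and of its inverse are equal integers, so that without an
involution the vanishing sum of the traces would make \<open>n\<close> even. So the elements of order at most
two in that subgroup form a non-trivial \<open>E\<close>. Second, \<open>D\<close> need not normalize this \<open>E\<close>, but any two normal subgroups of exponent
two commute elementwise (\<open>normal_involutions_elementwise_commute\<close>). Hence the union of all of them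
is again a normal subgroup of exponent two, and \<open>D\<close> normalizes it (\<open>normalizes_core\<close>).

Components are represented by their projections \<open>P\<close>, written as \<open>P = B C\<close> with \<open>C B = 1\<close> of size \<open>d\<close>.
Then \<open>d\<close> is the trace of \<open>P\<close>, and a matrix \<open>M\<close> commuting with \<open>P\<close> restricts to \<open>C M B\<close>.
\<close>

section \<open>Factoring idempotent matrices\<close>

lemma mat_mult_assoc_dim:
  "dim_col A = dim_row B \<Longrightarrow> dim_col B = dim_row C \<Longrightarrow> A * B * C = A * (B * (C :: 'a :: semiring_0 mat))"
  by (rule assoc_mult_mat[of A "dim_row A" "dim_row B" B "dim_row C" C "dim_col C"]) auto

text \<open>If \<open>X v = 0\<close> and \<open>v\<^sub>k \<noteq> 0\<close>, then \<open>X = X (1 - v e\<^sub>k\<^sup>T / v\<^sub>k)\<close>, and row \<open>k\<close> of the second factor vanishes.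
Deleting that row, together with column \<open>k\<close> of the first factor, leaves the product unchanged.\<close>

lemma singular_mat_factor:
  fixes X :: "'a :: field mat"
  assumes X: "X \<in> carrier_mat d d" and sing: "det X = 0"
  obtains Y Z where "Y \<in> carrier_mat d (d - 1)" "Z \<in> carrier_mat (d - 1) d" "X = Y * Z" "0 < d"
proof -
  from sing obtain v where v: "v \<in> carrier_vec d" and v0: "v \<noteq> 0\<^sub>v d" and Xv: "X *\<^sub>v v = 0\<^sub>v d"
    using det_0_iff_vec_prod_zero_field[OF X] by auto
  from v v0 obtain k where k: "k < d" and vk: "v $ k \<noteq> 0"
    by (metis carrier_vecD eq_vecI index_zero_vec)
  define Y where "Y = mat d (d - 1) (\<lambda>(i, j). X $$ (i, insert_index k j))"
  define f where "f l j = (if l = j then 1 else 0) - (if j = k then v $ l / v $ k else 0)" for l j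
  define Z where "Z = mat (d - 1) d (\<lambda>(i, j). f (insert_index k i) j)"
  have bij: "bij_betw (insert_index k) {0..<d - 1} ({0..<d} - {k})"
    using insert_index_image[of k "d - 1"] insert_index_inj_on[of k] k
    by (auto simp: bij_betw_def)
  have im: "insert_index k l < d" if "l < d - 1" for l
    using bij that k by (auto simp: insert_index_def)
  have "X = Y * Z"
  proof (rule eq_matI)
    fix i j assume "i < dim_row (Y * Z)" "j < dim_col (Y * Z)"
    hence i: "i < d" and j: "j < d" by (auto simp: Y_def Z_def)
    have "(Y * Z) $$ (i, j) = (\<Sum>l = 0..<d - 1. X $$ (i, insert_index k l) * f (insert_index k l) j)"
      using i j by (simp add: Y_def Z_def scalar_prod_def im)
    also have "\<dots> = (\<Sum>l \<in> {0..<d} - {k}. X $$ (i, l) * f l j)"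
      by (rule sum.reindex_bij_betw[OF bij])
    also have "\<dots> = (\<Sum>l \<in> {0..<d}. X $$ (i, l) * f l j)"
      using vk by (intro sum.mono_neutral_left) (auto simp: f_def)
    also have "\<dots> = (\<Sum>l \<in> {0..<d}. (if l = j then X $$ (i, l) else 0)
        - (if j = k then X $$ (i, l) * v $ l / v $ k else 0))"
      by (intro sum.cong) (auto simp: f_def right_diff_distrib)
    also have "\<dots> = (\<Sum>l \<in> {0..<d}. if l = j then X $$ (i, l) else 0)
        - (if j = k then (\<Sum>l \<in> {0..<d}. X $$ (i, l) * v $ l) / v $ k else 0)"
      by (simp add: sum_subtractf sum_divide_distrib)
    also have "(\<Sum>l \<in> {0..<d}. X $$ (i, l) * v $ l) = (X *\<^sub>v v) $ i"
      using i X v by (simp add: scalar_prod_def)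
    finally show "X $$ (i, j) = (Y * Z) $$ (i, j)" using i j Xv by simp
  qed (use X in \<open>auto simp: Y_def Z_def\<close>)
  moreover have "Y \<in> carrier_mat d (d - 1)" "Z \<in> carrier_mat (d - 1) d" by (auto simp: Y_def Z_def)
  ultimately show ?thesis using that k by auto
qed

text \<open>The matrix form of a basis of the image: the columns of \<open>B\<close> are the basis and \<open>C\<close> computes
coordinates, so a matrix \<open>M\<close> commuting with \<open>P\<close> restricts to the image as \<open>C M B\<close>. In a
factorization \<open>P = B C\<close> the square matrix \<open>X = C B\<close> satisfies \<open>X\<^sup>3 = X\<^sup>2\<close>. Either \<open>X\<close> is
invertible and hence the identity, or \<open>X\<close> is singular, and \<open>P = P\<^sup>2 = B X C\<close> factors through a
smaller dimension.\<close>

lemma idempotent_rank_factorization: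
  fixes P :: "'a :: field mat"
  assumes P: "P \<in> carrier_mat n n" and idem: "P * P = P"
  obtains d B C where "B \<in> carrier_mat n d" "C \<in> carrier_mat d n" "P = B * C" "C * B = 1\<^sub>m d"
proof -
  \<comment> \<open>The trivial factorization \<open>P = P * 1\<close> starts the descent on the inner dimension.\<close>
  have "\<exists>d B C. B \<in> carrier_mat n d \<and> C \<in> carrier_mat d n \<and> P = B * C \<and> C * B = 1\<^sub>m d"
    if "B \<in> carrier_mat n d" "C \<in> carrier_mat d n" "P = B * C" for B C d
    using that
  proof (induction d arbitrary: B C rule: less_induct)
    case (less d)
    note B = less.prems(1) and C = less.prems(2) and PBC = less.prems(3)
    define X where "X = C * B"
    have X: "X \<in> carrier_mat d d" using B C by (simp add: X_def)
    show ?case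
    proof (cases "det X = 0")
      case True
      then obtain Y Z where YZ: "Y \<in> carrier_mat d (d - 1)" "Z \<in> carrier_mat (d - 1) d" "X = Y * Z" "0 < d"
        using singular_mat_factor[OF X] by metis
      have "P = B * C * (B * C)" using idem PBC by simp
      also have "\<dots> = B * X * C"
        using B C by (simp add: X_def mat_mult_assoc_dim)
      also have "\<dots> = (B * Y) * (Z * C)"
        unfolding YZ(3) using B C YZ(1,2) by (simp add: mat_mult_assoc_dim)
      finally have "P = (B * Y) * (Z * C)" .
      moreover have "B * Y \<in> carrier_mat n (d - 1)" "Z * C \<in> carrier_mat (d - 1) n"
        using YZ B C by auto
      ultimately show ?thesis using less.IH[of "d - 1" "B * Y" "Z * C"] YZ(4) by auto
    next
      case False
      obtain W where W: "W \<in> carrier_mat d d" "W * X = 1\<^sub>m d"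
        using det_non_zero_imp_unit[OF X False, of "()"] by (auto simp: Units_def ring_mat_def)
      have Q: "B * C * (B * C) = B * C" using idem PBC by simp
      have "X * X * X = C * (B * C * (B * C)) * B"
        using B C by (simp add: X_def mat_mult_assoc_dim)
      also have "\<dots> = X * X" unfolding Q
        using B C by (simp add: X_def mat_mult_assoc_dim)
      finally have XXX: "X * X * X = X * X" .
      have WX: "W * (X * M) = M" if "M \<in> carrier_mat d d" for M
        using W X that by (simp flip: mat_mult_assoc_dim)
      have "W * (X * (X * X)) = W * (X * X)" using XXX X by (simp add: mat_mult_assoc_dim)
      hence "X * X = X" using WX[of "X * X"] WX[of X] X by simp
      hence "W * (X * X) = W * X" by simp
      hence "X = 1\<^sub>m d" using WX[of X] X W by simp
      then show ?thesis using B C PBC by (auto simp: X_def)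
    qed
  qed
  from this[of P n "1\<^sub>m n"] P show ?thesis using that by auto
qed

section \<open>Real eigenvectors in odd dimension\<close>

lemma odd_degree_real_poly_has_root:
  fixes p :: "real poly"
  assumes "odd (degree p)"
  obtains x where "poly p x = 0"
proof -
  have *: "\<exists>x. poly p x = 0" if lc: "lead_coeff p > 0" and od: "odd (degree p)" for p :: "real poly"
  proof -
    obtain a where a: "poly p a > 0"
      using poly_pinfty_gt_lc[OF lc] lc by (metis less_le_trans order_refl)
    \<comment> \<open>As the degree is odd, \<open>- p (- x)\<close> again has a positive leading coefficient.\<close>
    define q where "q = - (p \<circ>\<^sub>p [:0, -1:])"
    have "lead_coeff (p \<circ>\<^sub>p [:0, -1:]) = lead_coeff p * (-1) ^ degree p"
      by (subst lead_coeff_comp) auto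
    hence "lead_coeff q > 0"
      unfolding q_def lead_coeff_minus using lc od by (simp only: power_minus_odd) simp
    then obtain b where b: "poly q b > 0"
      using poly_pinfty_gt_lc[of q] by (metis less_le_trans order_refl)
    hence b': "poly p (- b) < 0" by (simp add: q_def poly_pcompose)
    show ?thesis
    proof (cases "a < - b")
      case True then show ?thesis using poly_IVT_neg[of a "-b" p] a b' by auto
    next
      case False
      hence "- b < a" using a b' by (metis linorder_neqE_linordered_idom order_less_asym)
      then show ?thesis using poly_IVT_pos[of "-b" a p] a b' by auto
    qed
  qed
  have "p \<noteq> 0" using assms by auto
  hence "lead_coeff p > 0 \<or> lead_coeff (- p) > 0"
    by (metis leading_coeff_neq_0 lead_coeff_minus linorder_neqE_linordered_idom neg_0_less_iff_less)
  hence "\<exists>x. poly p x = 0"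
    using *[of p] *[of "- p"] assms by (metis degree_minus neg_equal_0_iff_equal poly_minus)
  thus ?thesis using that by blast
qed

lemma odd_dim_real_eigenvector:
  fixes M :: "real mat"
  assumes M: "M \<in> carrier_mat d d" and "odd d"
  obtains v l where "v \<in> carrier_vec d" "v \<noteq> 0\<^sub>v d" "M *\<^sub>v v = l \<cdot>\<^sub>v v"
proof -
  have "odd (degree (char_poly M))" using degree_monic_char_poly[OF M] assms by simp
  then obtain l where "eigenvalue M l"
    using odd_degree_real_poly_has_root eigenvalue_root_char_poly[OF M] by metis
  then show ?thesis using that M by (auto simp: eigenvalue_def eigenvector_def)
qed

section \<open>Traces and finite sums of matrices\<close>

definition mat_trace :: "'a :: comm_ring_1 mat \<Rightarrow> 'a" where
  "mat_trace M = (\<Sum>i < dim_row M. M $$ (i, i))"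

lemma mat_trace_mult_comm:
  assumes "B \<in> carrier_mat n m" "C \<in> carrier_mat m n"
  shows "mat_trace (B * C) = mat_trace (C * B)"
proof -
  have "mat_trace (B * C) = (\<Sum>i<n. \<Sum>j<m. B $$ (i, j) * C $$ (j, i))"
    using assms by (simp add: mat_trace_def scalar_prod_def atLeast0LessThan)
  also have "\<dots> = (\<Sum>j<m. \<Sum>i<n. C $$ (j, i) * B $$ (i, j))"
    by (subst sum.swap) (simp add: mult.commute)
  also have "\<dots> = mat_trace (C * B)"
    using assms by (simp add: mat_trace_def scalar_prod_def atLeast0LessThan)
  finally show ?thesis .
qed

lemma mat_trace_one: "mat_trace (1\<^sub>m n) = of_nat n"
  by (simp add: mat_trace_def)

lemma mat_trace_transpose: "M \<in> carrier_mat n n \<Longrightarrow> mat_trace M\<^sup>T = mat_trace M"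
  by (simp add: mat_trace_def)

text \<open>Matrices of a fixed size do not form a type of class \<^class>\<open>comm_monoid_add\<close>, so \<^const>\<open>sum\<close>
is applied entrywise; the size is an argument because the index set may be empty.\<close>

definition msum :: "nat \<Rightarrow> ('b \<Rightarrow> 'a :: comm_ring_1 mat) \<Rightarrow> 'b set \<Rightarrow> 'a mat" where
  "msum n f I = mat n n (\<lambda>(i, j). \<Sum>k\<in>I. f k $$ (i, j))"

lemma msum_carrier [simp]: "msum n f I \<in> carrier_mat n n"
  and msum_dim [simp]: "dim_row (msum n f I) = n" "dim_col (msum n f I) = n"
  by (auto simp: msum_def)

lemma msum_cong: "I = J \<Longrightarrow> (\<And>k. k \<in> J \<Longrightarrow> f k = g k) \<Longrightarrow> msum n f I = msum n g J"
  by (auto simp: msum_def)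

lemma msum_reindex: "bij_betw h I J \<Longrightarrow> msum n (\<lambda>k. f (h k)) I = msum n f J"
  by (auto simp: msum_def sum.reindex_bij_betw[of h I J "\<lambda>k. f k $$ _"])

lemma mult_msum:
  assumes M: "M \<in> carrier_mat n n" and f: "\<And>k. k \<in> I \<Longrightarrow> f k \<in> carrier_mat n n"
  shows "M * msum n f I = msum n (\<lambda>k. M * f k) I"
proof (rule eq_matI)
  fix i j assume "i < dim_row (msum n (\<lambda>k. M * f k) I)" "j < dim_col (msum n (\<lambda>k. M * f k) I)"
  hence ij: "i < n" "j < n" by auto
  have "(M * msum n f I) $$ (i, j) = (\<Sum>l<n. \<Sum>k\<in>I. M $$ (i, l) * f k $$ (l, j))"
    using M ij by (simp add: msum_def scalar_prod_def atLeast0LessThan sum_distrib_left)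
  also have "\<dots> = (\<Sum>k\<in>I. \<Sum>l<n. M $$ (i, l) * f k $$ (l, j))" by (rule sum.swap)
  also have "\<dots> = (\<Sum>k\<in>I. (M * f k) $$ (i, j))"
    using M ij f by (intro sum.cong) (auto simp: scalar_prod_def atLeast0LessThan dest!: f)
  finally show "(M * msum n f I) $$ (i, j) = msum n (\<lambda>k. M * f k) I $$ (i, j)"
    using ij by (simp add: msum_def)
qed (use M in auto)

lemma msum_mult:
  assumes M: "M \<in> carrier_mat n n" and f: "\<And>k. k \<in> I \<Longrightarrow> f k \<in> carrier_mat n n"
  shows "msum n f I * M = msum n (\<lambda>k. f k * M) I"
proof (rule eq_matI)
  fix i j assume "i < dim_row (msum n (\<lambda>k. f k * M) I)" "j < dim_col (msum n (\<lambda>k. f k * M) I)"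
  hence ij: "i < n" "j < n" by auto
  have "(msum n f I * M) $$ (i, j) = (\<Sum>l<n. \<Sum>k\<in>I. f k $$ (i, l) * M $$ (l, j))"
    using M ij by (simp add: msum_def scalar_prod_def atLeast0LessThan sum_distrib_right)
  also have "\<dots> = (\<Sum>k\<in>I. \<Sum>l<n. f k $$ (i, l) * M $$ (l, j))" by (rule sum.swap)
  also have "\<dots> = (\<Sum>k\<in>I. (f k * M) $$ (i, j))"
    using M ij f by (intro sum.cong) (auto simp: scalar_prod_def atLeast0LessThan dest!: f)
  finally show "(msum n f I * M) $$ (i, j) = msum n (\<lambda>k. f k * M) I $$ (i, j)"
    using ij by (simp add: msum_def)
qed (use M in auto)

lemma smult_msum:
  assumes "\<And>k. k \<in> I \<Longrightarrow> f k \<in> carrier_mat n n"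
  shows "c \<cdot>\<^sub>m msum n f I = msum n (\<lambda>k. c \<cdot>\<^sub>m f k) I"
proof (rule eq_matI)
  fix i j assume "i < dim_row (msum n (\<lambda>k. c \<cdot>\<^sub>m f k) I)" "j < dim_col (msum n (\<lambda>k. c \<cdot>\<^sub>m f k) I)"
  hence ij: "i < n" "j < n" by auto
  have "(c \<cdot>\<^sub>m f k) $$ (i, j) = c * f k $$ (i, j)" if "k \<in> I" for k
    using assms[OF that] ij by auto
  thus "(c \<cdot>\<^sub>m msum n f I) $$ (i, j) = msum n (\<lambda>k. c \<cdot>\<^sub>m f k) I $$ (i, j)"
    using ij by (simp add: msum_def sum_distrib_left)
qed auto

lemma msum_const:
  assumes "M \<in> carrier_mat n n" shows "msum n (\<lambda>_. M) I = of_nat (card I) \<cdot>\<^sub>m M"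
  using assms by (intro eq_matI) (auto simp: msum_def)

lemma msum_delta:
  assumes "finite I" "k \<in> I" "M \<in> carrier_mat n n"
  shows "msum n (\<lambda>l. if l = k then M else 0\<^sub>m n n) I = M"
proof (rule eq_matI)
  fix i j assume "i < dim_row M" "j < dim_col M"
  hence ij: "i < n" "j < n" using assms by auto
  have "(\<Sum>l\<in>I. (if l = k then M else 0\<^sub>m n n) $$ (i, j)) = (\<Sum>l\<in>I. if l = k then M $$ (i, j) else 0)"
    using ij by (intro sum.cong) auto
  thus "msum n (\<lambda>l. if l = k then M else 0\<^sub>m n n) I $$ (i, j) = M $$ (i, j)"
    using ij assms by (simp add: msum_def)
qed (use assms in auto)

lemma mat_trace_msum:
  assumes "\<And>k. k \<in> I \<Longrightarrow> f k \<in> carrier_mat n n"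
  shows "mat_trace (msum n f I) = (\<Sum>k\<in>I. mat_trace (f k))"
proof -
  have "mat_trace (msum n f I) = (\<Sum>i<n. \<Sum>k\<in>I. f k $$ (i, i))"
    by (simp add: mat_trace_def msum_def)
  also have "\<dots> = (\<Sum>k\<in>I. \<Sum>i<n. f k $$ (i, i))" by (rule sum.swap)
  also have "\<dots> = (\<Sum>k\<in>I. mat_trace (f k))"
    using assms by (intro sum.cong) (auto simp: mat_trace_def dest!: assms)
  finally show ?thesis .
qed

lemma msum_mult_vec_index:
  assumes v: "v \<in> carrier_vec n" and f: "\<And>k. k \<in> I \<Longrightarrow> f k \<in> carrier_mat n n" and i: "i < n"
  shows "(msum n f I *\<^sub>v v) $ i = (\<Sum>k\<in>I. (f k *\<^sub>v v) $ i)"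
proof -
  have "(msum n f I *\<^sub>v v) $ i = (\<Sum>j<n. \<Sum>k\<in>I. f k $$ (i, j) * v $ j)"
    using v i by (simp add: msum_def scalar_prod_def atLeast0LessThan sum_distrib_right)
  also have "\<dots> = (\<Sum>k\<in>I. \<Sum>j<n. f k $$ (i, j) * v $ j)" by (rule sum.swap)
  also have "\<dots> = (\<Sum>k\<in>I. (f k *\<^sub>v v) $ i)"
  proof (rule sum.cong[OF refl])
    fix k assume "k \<in> I"
    from f[OF this] show "(\<Sum>j<n. f k $$ (i, j) * v $ j) = (f k *\<^sub>v v) $ i"
      using v i by (simp add: scalar_prod_def atLeast0LessThan)
  qed
  finally show ?thesis .
qed

lemma smult_mat_mult_vec:
  fixes M :: "'a :: comm_ring_1 mat"
  assumes "M \<in> carrier_mat n m" "v \<in> carrier_vec m"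
  shows "(c \<cdot>\<^sub>m M) *\<^sub>v v = c \<cdot>\<^sub>v (M *\<^sub>v v)"
  using assms by (intro eq_vecI) auto

lemma scalar_prod_msum:
  fixes v :: "'a :: comm_ring_1 vec"
  assumes v: "v \<in> carrier_vec n" and f: "\<And>k. k \<in> I \<Longrightarrow> f k \<in> carrier_mat n n"
  shows "v \<bullet> (msum n f I *\<^sub>v v) = (\<Sum>k\<in>I. v \<bullet> (f k *\<^sub>v v))"
proof -
  have "v \<bullet> (msum n f I *\<^sub>v v) = (\<Sum>i<n. \<Sum>j<n. \<Sum>k\<in>I. v $ i * (f k $$ (i, j) * v $ j))"
    using v by (simp add: msum_def scalar_prod_def atLeast0LessThan sum_distrib_left sum_distrib_right)
  also have "\<dots> = (\<Sum>i<n. \<Sum>k\<in>I. \<Sum>j<n. v $ i * (f k $$ (i, j) * v $ j))"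
    by (intro sum.cong refl sum.swap)
  also have "\<dots> = (\<Sum>k\<in>I. \<Sum>i<n. \<Sum>j<n. v $ i * (f k $$ (i, j) * v $ j))"
    by (rule sum.swap)
  also have "\<dots> = (\<Sum>k\<in>I. v \<bullet> (f k *\<^sub>v v))"
  proof (rule sum.cong[OF refl])
    fix k assume "k \<in> I"
    from f[OF this] show "(\<Sum>i<n. \<Sum>j<n. v $ i * (f k $$ (i, j) * v $ j)) = v \<bullet> (f k *\<^sub>v v)"
      using v by (simp add: scalar_prod_def atLeast0LessThan sum_distrib_left)
  qed
  finally show ?thesis .
qed

lemma real_scalar_prod_self:
  fixes v :: "real vec"
  shows "0 \<le> v \<bullet> v" "v \<in> carrier_vec n \<Longrightarrow> v \<bullet> v = 0 \<longleftrightarrow> v = 0\<^sub>v n"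
  by (auto simp: scalar_prod_def sum_nonneg sum_nonneg_eq_0_iff intro!: eq_vecI sum_nonneg)

lemma smult_mat_cancel:
  fixes A B :: "'a :: field mat"
  assumes c: "c \<noteq> 0" and eq: "c \<cdot>\<^sub>m A = c \<cdot>\<^sub>m B"
  shows "A = B"
proof -
  have dims: "dim_row A = dim_row B" "dim_col A = dim_col B"
    using arg_cong[OF eq, of dim_row] arg_cong[OF eq, of dim_col] by simp_all
  show ?thesis
  proof (rule eq_matI)
    fix i j assume ij: "i < dim_row B" "j < dim_col B"
    have "(c \<cdot>\<^sub>m A) $$ (i, j) = (c \<cdot>\<^sub>m B) $$ (i, j)" by (simp only: eq)
    thus "A $$ (i, j) = B $$ (i, j)" using ij dims c by simp
  qed (use dims in auto)
qed

lemma mat_eq_0_if_mult_vec_eq_0: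
  fixes M :: "'a :: comm_ring_1 mat"
  assumes M: "M \<in> carrier_mat n n" and "\<And>v. v \<in> carrier_vec n \<Longrightarrow> M *\<^sub>v v = 0\<^sub>v n"
  shows "M = 0\<^sub>m n n"
proof (rule eq_matI)
  fix i j assume "i < dim_row (0\<^sub>m n n :: 'a mat)" "j < dim_col (0\<^sub>m n n :: 'a mat)"
  hence ij: "i < n" "j < n" by auto
  have "M $$ (i, j) = (M *\<^sub>v unit_vec n j) $ i" using M ij by simp
  thus "M $$ (i, j) = 0\<^sub>m n n $$ (i, j)" using assms(2)[of "unit_vec n j"] ij by simp
qed (use M in auto)

text \<open>The orbits of \<open>i\<close> are pairs on which \<open>f\<close> is constant.\<close>

lemma even_sum_free_involution:
  fixes f :: "'b \<Rightarrow> int"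
  assumes "finite S" "\<And>x. x \<in> S \<Longrightarrow> i x \<in> S" "\<And>x. x \<in> S \<Longrightarrow> i (i x) = x"
    "\<And>x. x \<in> S \<Longrightarrow> i x \<noteq> x" "\<And>x. x \<in> S \<Longrightarrow> f (i x) = f x"
  shows "even (sum f S)"
  using assms
proof (induction S rule: finite_psubset_induct)
  case (psubset S)
  show ?case
  proof (cases "S = {}")
    case False
    then obtain x where x: "x \<in> S" by auto
    have ix: "i x \<in> S" "i x \<noteq> x" "i (i x) = x" "f (i x) = f x" using psubset.prems x by auto
    have "even (sum f (S - {x, i x}))"
    proof (rule psubset.IH)
      fix y assume y: "y \<in> S - {x, i x}"
      hence "i y \<noteq> x" "i y \<noteq> i x" using psubset.prems(2) x ix by (metis DiffE insertCI)+
      thus "i y \<in> S - {x, i x}" using y psubset.prems(1) by auto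
    qed (use psubset.prems x in auto)
    moreover have "sum f S = sum f (S - {x, i x}) + sum f {x, i x}"
      using psubset.hyps x ix by (intro sum.subset_diff) auto
    ultimately show ?thesis using ix by simp
  qed simp
qed

section \<open>Irreducible matrix groups in odd dimension\<close>

text \<open>The image of the representation as a concrete set of real matrices. Irreducibility is spelled out
for subsets of \<^term>\<open>carrier_vec n\<close> closed under the linear operations.\<close>

locale odd_irreducible_matrix_group =
  fixes n :: nat and \<Gamma> :: "real mat set"
  assumes odd_n: "odd n"
    and finite_group: "finite \<Gamma>"
    and group_carrier: "g \<in> \<Gamma> \<Longrightarrow> g \<in> carrier_mat n n"
    and one_in_group: "1\<^sub>m n \<in> \<Gamma>"
    and mult_in_group: "g \<in> \<Gamma> \<Longrightarrow> h \<in> \<Gamma> \<Longrightarrow> g * h \<in> \<Gamma>"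
    and inverse_in_group: "g \<in> \<Gamma> \<Longrightarrow> \<exists>h\<in>\<Gamma>. g * h = 1\<^sub>m n \<and> h * g = 1\<^sub>m n"
    and irreducible: "W \<subseteq> carrier_vec n \<Longrightarrow> 0\<^sub>v n \<in> W \<Longrightarrow> (\<And>u w. u \<in> W \<Longrightarrow> w \<in> W \<Longrightarrow> u + w \<in> W) \<Longrightarrow>
      (\<And>c w. w \<in> W \<Longrightarrow> c \<cdot>\<^sub>v w \<in> W) \<Longrightarrow> (\<And>g w. g \<in> \<Gamma> \<Longrightarrow> w \<in> W \<Longrightarrow> g *\<^sub>v w \<in> W) \<Longrightarrow>
      W = {0\<^sub>v n} \<or> W = carrier_vec n"
begin

text \<open>Schur's lemma: the eigenspace of \<open>C\<close> containing \<open>v\<close> is invariant and not zero.\<close>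

lemma commutant_scalar_if_eigenvector:
  assumes C: "C \<in> carrier_mat n n" and comm: "\<And>g. g \<in> \<Gamma> \<Longrightarrow> C * g = g * C"
    and v: "v \<in> carrier_vec n" "v \<noteq> 0\<^sub>v n" "C *\<^sub>v v = l \<cdot>\<^sub>v v"
  shows "C = l \<cdot>\<^sub>m 1\<^sub>m n"
proof -
  define W where "W = {w \<in> carrier_vec n. C *\<^sub>v w = l \<cdot>\<^sub>v w}"
  have "W = {0\<^sub>v n} \<or> W = carrier_vec n"
  proof (rule irreducible)
    fix g w assume g: "g \<in> \<Gamma>" and w: "w \<in> W"
    note gc = group_carrier[OF g]
    have "C *\<^sub>v (g *\<^sub>v w) = (C * g) *\<^sub>v w"
      using C gc w by (simp add: W_def assoc_mult_mat_vec[of _ n n _ n])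
    also have "\<dots> = g *\<^sub>v (C *\<^sub>v w)"
      unfolding comm[OF g] using C gc w by (simp add: W_def assoc_mult_mat_vec[of _ n n _ n])
    also have "\<dots> = l \<cdot>\<^sub>v (g *\<^sub>v w)" using w gc by (simp add: W_def mult_mat_vec[of _ n n])
    finally show "g *\<^sub>v w \<in> W" using w gc by (simp add: W_def)
  qed (use C in \<open>auto simp: W_def mult_add_distrib_mat_vec[of _ n n] smult_add_distrib_vec[of _ n]
      mult_mat_vec[of _ n n] smult_smult_assoc mult.commute\<close>)
  hence W: "W = carrier_vec n" using v by (auto simp: W_def)
  have eq: "C *\<^sub>v w = l \<cdot>\<^sub>v w" if "w \<in> carrier_vec n" for w using that W by (auto simp: W_def)
  show ?thesis
  proof (rule eq_matI)
    fix i j assume "i < dim_row (l \<cdot>\<^sub>m 1\<^sub>m n)" "j < dim_col (l \<cdot>\<^sub>m 1\<^sub>m n)"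
    hence ij: "i < n" "j < n" by auto
    have "C $$ (i, j) = (C *\<^sub>v unit_vec n j) $ i" using C ij by simp
    also have "\<dots> = (l \<cdot>\<^sub>m 1\<^sub>m n) $$ (i, j)" unfolding eq[OF unit_vec_carrier] using ij by simp
    finally show "C $$ (i, j) = (l \<cdot>\<^sub>m 1\<^sub>m n) $$ (i, j)" .
  qed (use C in auto)
qed

text \<open>In odd dimension the eigenvector that Schur's lemma asks for always exists over the reals.\<close>

lemma commutant_scalar:
  assumes C: "C \<in> carrier_mat n n" and comm: "\<And>g. g \<in> \<Gamma> \<Longrightarrow> C * g = g * C"
  obtains l where "C = l \<cdot>\<^sub>m 1\<^sub>m n"
  using odd_dim_real_eigenvector[OF C odd_n] commutant_scalar_if_eigenvector[OF C comm] by metis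

text \<open>Conjugation by a group element permutes the summands.\<close>

lemma conj_invariant_sum_commutes:
  assumes X: "\<And>x. x \<in> X \<Longrightarrow> x \<in> carrier_mat n n"
    and conjX: "\<And>g h x. g \<in> \<Gamma> \<Longrightarrow> h \<in> \<Gamma> \<Longrightarrow> g * h = 1\<^sub>m n \<Longrightarrow> x \<in> X \<Longrightarrow> g * x * h \<in> X"
    and g: "g \<in> \<Gamma>"
  shows "msum n (\<lambda>x. x) X * g = g * msum n (\<lambda>x. x) X"
proof -
  let ?Q = "msum n (\<lambda>x. x) X"
  obtain h where h: "h \<in> \<Gamma>" "g * h = 1\<^sub>m n" "h * g = 1\<^sub>m n" using inverse_in_group[OF g] by auto
  note gc = group_carrier[OF g] and hc = group_carrier[OF h(1)]
  have hg: "h * (g * x) = x" "g * (h * x) = x" if "x \<in> carrier_mat n n" for x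
    using that gc hc h(2,3) by (simp_all flip: mat_mult_assoc_dim)
  have "h * (g * x * h) * g = x" "g * (h * x * g) * h = x" if "x \<in> X" for x
    using X[OF that] gc hc hg h(2,3) by (simp_all add: mat_mult_assoc_dim)
  hence "bij_betw (\<lambda>x. g * x * h) X X"
    using conjX[of g h] conjX[of h g] g h
    by (intro bij_betw_byWitness[of _ "\<lambda>x. h * x * g"]) auto
  from msum_reindex[OF this, of n "\<lambda>x. x"] have "?Q = msum n (\<lambda>x. g * x * h) X"
    by simp
  also have "\<dots> = g * ?Q * h"
    using gc hc X by (simp add: mult_msum msum_mult)
  finally have "?Q * g = g * ?Q * h * g" by simp
  also have "\<dots> = g * ?Q" using gc hc h by (simp add: mat_mult_assoc_dim)
  finally show ?thesis .
qed

text \<open>Averaging gives an invariant inner product \<open>S\<close>. With respect to it the inverse of \<open>a\<close> is its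
adjoint \<open>inverse(S) a\<^sup>T S\<close>, which has the trace of \<open>a\<close>.\<close>

lemma mat_trace_inverse:
  assumes a: "a \<in> \<Gamma>" and b: "b \<in> \<Gamma>" and ab: "a * b = 1\<^sub>m n"
  shows "mat_trace b = mat_trace a"
proof -
  note ac = group_carrier[OF a] and bc = group_carrier[OF b]
  define S where "S = msum n (\<lambda>g. g\<^sup>T * g) \<Gamma>"
  have S: "S \<in> carrier_mat n n" by (simp add: S_def)
  have gg: "g\<^sup>T * g \<in> carrier_mat n n" if "g \<in> \<Gamma>" for g using group_carrier[OF that] by simp
  have ba: "b * a = 1\<^sub>m n" by (rule mat_mult_left_right_inverse[OF ac bc ab])
  have "x * a * b = x" "x * b * a = x" if "x \<in> \<Gamma>" for x
    using group_carrier[OF that] ac bc ab ba by (simp_all add: mat_mult_assoc_dim)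
  hence "bij_betw (\<lambda>g. g * a) \<Gamma> \<Gamma>"
    using a b by (intro bij_betw_byWitness[of _ "\<lambda>g. g * b"]) (auto intro: mult_in_group)
  hence "S = msum n (\<lambda>g. (g * a)\<^sup>T * (g * a)) \<Gamma>"
    unfolding S_def by (rule msum_reindex[symmetric])
  also have "\<dots> = msum n (\<lambda>g. a\<^sup>T * (g\<^sup>T * g) * a) \<Gamma>"
  proof (rule msum_cong[OF refl])
    fix g assume "g \<in> \<Gamma>"
    from group_carrier[OF this] show "(g * a)\<^sup>T * (g * a) = a\<^sup>T * (g\<^sup>T * g) * a"
      using ac by (simp add: transpose_mult[of _ n n _ n] mat_mult_assoc_dim)
  qed
  also have "\<dots> = a\<^sup>T * S * a"
    unfolding S_def using ac gg by (simp add: mult_msum msum_mult)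
  finally have inv: "a\<^sup>T * S * a = S" ..
  have "det S \<noteq> 0"
  proof
    assume "det S = 0"
    then obtain v where v: "v \<in> carrier_vec n" "v \<noteq> 0\<^sub>v n" "S *\<^sub>v v = 0\<^sub>v n"
      using det_0_iff_vec_prod_zero_field[OF S] by blast
    have nn: "v \<bullet> ((g\<^sup>T * g) *\<^sub>v v) = (g *\<^sub>v v) \<bullet> (g *\<^sub>v v)" if "g \<in> \<Gamma>" for g
    proof -
      note gc = group_carrier[OF that]
      have "(g\<^sup>T * g) *\<^sub>v v = g\<^sup>T *\<^sub>v (g *\<^sub>v v)"
        using gc v(1) by (intro assoc_mult_mat_vec[of _ n n _ n]) auto
      moreover have "v \<bullet> (g\<^sup>T *\<^sub>v (g *\<^sub>v v)) = (g\<^sup>T *\<^sub>v (g *\<^sub>v v)) \<bullet> v"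
        using gc v(1) by (intro comm_scalar_prod[of _ n]) auto
      ultimately show ?thesis
        using transpose_vec_mult_scalar[OF gc v(1), of "g *\<^sub>v v"] gc v(1) by simp
    qed
    have "0 = v \<bullet> (S *\<^sub>v v)" using v by simp
    also have "\<dots> = (\<Sum>g\<in>\<Gamma>. (g *\<^sub>v v) \<bullet> (g *\<^sub>v v))"
      unfolding S_def by (subst scalar_prod_msum[OF v(1) gg]) (auto intro!: sum.cong nn)
    also have "\<dots> \<ge> (1\<^sub>m n *\<^sub>v v) \<bullet> (1\<^sub>m n *\<^sub>v v)"
      by (rule member_le_sum[OF one_in_group _ finite_group]) (rule real_scalar_prod_self)
    finally show False using v real_scalar_prod_self(1)[of v] real_scalar_prod_self(2)[of v n] by simp
  qed
  then obtain T where T: "T \<in> carrier_mat n n" "T * S = 1\<^sub>m n" "S * T = 1\<^sub>m n"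
    using det_non_zero_imp_unit[OF S, of "()"] by (auto simp: Units_def ring_mat_def)
  have "a\<^sup>T * S * a * b = S * b" using inv by simp
  hence "S * b = a\<^sup>T * S" using ac bc S ab by (simp add: mat_mult_assoc_dim)
  hence "T * (S * b) = T * (a\<^sup>T * S)" by simp
  moreover have "T * (S * b) = b" using T S bc by (simp flip: mat_mult_assoc_dim)
  ultimately have "b = T * (a\<^sup>T * S)" by simp
  hence "mat_trace b = mat_trace (a\<^sup>T * S * T)"
    using mat_trace_mult_comm[OF T(1), of "a\<^sup>T * S"] ac S by simp
  also have "a\<^sup>T * S * T = a\<^sup>T" using T S ac by (simp add: mat_mult_assoc_dim)
  finally show ?thesis using mat_trace_transpose[OF ac] by simp
qed

definition normal_subgroup_set :: "real mat set \<Rightarrow> bool" where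
  "normal_subgroup_set N \<longleftrightarrow> N \<subseteq> \<Gamma> \<and> 1\<^sub>m n \<in> N \<and> (\<forall>a\<in>N. \<forall>b\<in>N. a * b \<in> N) \<and>
     (\<forall>a\<in>N. \<exists>b\<in>N. a * b = 1\<^sub>m n \<and> b * a = 1\<^sub>m n) \<and>
     (\<forall>g\<in>\<Gamma>. \<forall>g'\<in>\<Gamma>. g * g' = 1\<^sub>m n \<longrightarrow> (\<forall>a\<in>N. g * a * g' \<in> N))"

text \<open>The sum \<open>Q\<close> over a non-trivial normal subgroup \<open>N\<close> vanishes: its image is fixed by \<open>N\<close>, so by
Schur's lemma a non-zero \<open>Q\<close> would be an invertible scalar and \<open>N\<close> would act trivially. Hence the
traces of the elements of \<open>N\<close> add up to zero. The identity contributes the odd number \<open>n\<close>, and if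
\<open>N\<close> had no involution, the other elements would come in pairs of inverses with equal integral
traces.\<close>

lemma normal_subgroup_has_involution:
  assumes N: "normal_subgroup_set N" and nontriv: "N \<noteq> {1\<^sub>m n}"
    and int: "\<And>g. g \<in> \<Gamma> \<Longrightarrow> mat_trace g \<in> \<int>"
  obtains c where "c \<in> N" "c \<noteq> 1\<^sub>m n" "c * c = 1\<^sub>m n"
proof (rule ccontr)
  assume "\<not> thesis"
  with that have no_inv: "c = 1\<^sub>m n" if "c \<in> N" "c * c = 1\<^sub>m n" for c using that by blast
  have sub: "N \<subseteq> \<Gamma>" and oneN: "1\<^sub>m n \<in> N" and mulN: "\<And>a b. a \<in> N \<Longrightarrow> b \<in> N \<Longrightarrow> a * b \<in> N"
    and invN: "\<And>a. a \<in> N \<Longrightarrow> \<exists>b\<in>N. a * b = 1\<^sub>m n \<and> b * a = 1\<^sub>m n"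
    and conjN: "\<And>g g' a. g \<in> \<Gamma> \<Longrightarrow> g' \<in> \<Gamma> \<Longrightarrow> g * g' = 1\<^sub>m n \<Longrightarrow> a \<in> N \<Longrightarrow> g * a * g' \<in> N"
    using N by (auto simp: normal_subgroup_set_def)
  have Nc: "a \<in> carrier_mat n n" if "a \<in> N" for a using that sub group_carrier by auto
  have finN: "finite N" using sub finite_group finite_subset by auto
  define Q where "Q = msum n (\<lambda>a. a) N"
  have Q: "Q \<in> carrier_mat n n" by (simp add: Q_def)
  have absorb: "a * Q = Q" if a: "a \<in> N" for a
  proof -
    obtain b where b: "b \<in> N" "a * b = 1\<^sub>m n" "b * a = 1\<^sub>m n" using invN[OF a] by auto
    have ab: "a * (b * x) = x" "b * (a * x) = x" if "x \<in> N" for x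
      using Nc[OF that] Nc[OF a] Nc[OF b(1)] b(2,3) by (simp_all flip: mat_mult_assoc_dim)
    have "bij_betw (\<lambda>x. a * x) N N"
      by (rule bij_betw_byWitness[of _ "\<lambda>x. b * x"]) (use a b ab in \<open>auto simp: mulN\<close>)
    from msum_reindex[OF this, of n "\<lambda>x. x"] show ?thesis
      unfolding Q_def by (subst mult_msum) (use Nc a in auto)
  qed
  have comm: "Q * g = g * Q" if "g \<in> \<Gamma>" for g
    unfolding Q_def using Nc conjN that by (rule conj_invariant_sum_commutes)
  have "Q = 0\<^sub>m n n"
  proof (rule ccontr)
    assume "Q \<noteq> 0\<^sub>m n n"
    then obtain v where v: "v \<in> carrier_vec n" "Q *\<^sub>v v \<noteq> 0\<^sub>v n"
      using mat_eq_0_if_mult_vec_eq_0[OF Q] by auto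
    have "Q * Q = msum n (\<lambda>a. a * Q) N"
      using msum_mult[OF Q, of N "\<lambda>a. a"] Nc by (simp add: Q_def)
    also have "\<dots> = msum n (\<lambda>_. Q) N" by (intro msum_cong refl absorb)
    also have "\<dots> = real (card N) \<cdot>\<^sub>m Q" by (rule msum_const[OF Q])
    finally have QQ: "Q * Q = real (card N) \<cdot>\<^sub>m Q" .
    have "Q *\<^sub>v (Q *\<^sub>v v) = (Q * Q) *\<^sub>v v" using Q v by (simp add: assoc_mult_mat_vec[of _ n n _ n])
    also have "\<dots> = real (card N) \<cdot>\<^sub>v (Q *\<^sub>v v)"
      unfolding QQ using Q v by (auto intro!: eq_vecI)
    finally have "Q = real (card N) \<cdot>\<^sub>m 1\<^sub>m n"
      using commutant_scalar_if_eigenvector[OF Q comm, of "Q *\<^sub>v v"] Q v by auto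
    moreover have "real (card N) \<noteq> 0" using finN oneN by auto
    ultimately have "a = 1\<^sub>m n" if "a \<in> N" for a
    proof -
      assume *: "Q = real (card N) \<cdot>\<^sub>m 1\<^sub>m n" "real (card N) \<noteq> 0"
      have "real (card N) \<cdot>\<^sub>m a = real (card N) \<cdot>\<^sub>m 1\<^sub>m n"
        using absorb[OF that] Nc[OF that] unfolding *(1)
        by (simp add: mult_smult_distrib[of _ n n _ n])
      with *(2) show ?thesis by (rule smult_mat_cancel)
    qed
    thus False using nontriv oneN by blast
  qed
  hence "mat_trace Q = 0" by (simp add: mat_trace_def)
  hence sum0: "(\<Sum>a\<in>N. mat_trace a) = 0" using mat_trace_msum[of N "\<lambda>a. a" n] Nc by (simp add: Q_def)
  define i where "i a = (SOME b. b \<in> N \<and> a * b = 1\<^sub>m n \<and> b * a = 1\<^sub>m n)" for a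
  have "\<exists>b. b \<in> N \<and> a * b = 1\<^sub>m n \<and> b * a = 1\<^sub>m n" if "a \<in> N" for a
    using invN[OF that] by blast
  from someI_ex[OF this] have i: "i a \<in> N" "a * i a = 1\<^sub>m n" "i a * a = 1\<^sub>m n" if "a \<in> N" for a
    using that unfolding i_def by blast+
  have uniq: "i a = b" if "a \<in> N" "b \<in> N" "a * b = 1\<^sub>m n" for a b
  proof -
    note car = Nc[OF that(1)] Nc[OF that(2)] Nc[OF i(1)[OF that(1)]]
    have "i a = i a * (a * b)" using that(3) car by simp
    also have "\<dots> = b" using i(3)[OF that(1)] car by (simp flip: mat_mult_assoc_dim)
    finally show ?thesis .
  qed
  have fl: "real_of_int \<lfloor>mat_trace a\<rfloor> = mat_trace a" if "a \<in> N" for a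
    using int[of a] that sub of_int_floor by blast
  have "even (\<Sum>a\<in>N - {1\<^sub>m n}. \<lfloor>mat_trace a\<rfloor>)"
  proof (rule even_sum_free_involution[where i = i])
    fix a assume a: "a \<in> N - {1\<^sub>m n}"
    show ii: "i (i a) = a" using uniq[of "i a" a] i[of a] a by auto
    have "i (1\<^sub>m n) = 1\<^sub>m n" using uniq[OF oneN oneN] by simp
    thus "i a \<in> N - {1\<^sub>m n}" using i a ii by auto
    show "i a \<noteq> a" using no_inv[of a] i[of a] a by auto
    have "mat_trace (i a) = mat_trace a"
      using mat_trace_inverse[of a "i a"] i[of a] a sub by blast
    thus "\<lfloor>mat_trace (i a)\<rfloor> = \<lfloor>mat_trace a\<rfloor>" by simp
  qed (use finN in auto)
  moreover have "(\<Sum>a\<in>N. \<lfloor>mat_trace a\<rfloor>) = \<lfloor>mat_trace (1\<^sub>m n :: real mat)\<rfloor> + (\<Sum>a\<in>N - {1\<^sub>m n}. \<lfloor>mat_trace a\<rfloor>)"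
    using finN oneN by (rule sum.remove)
  moreover have "(\<Sum>a\<in>N. \<lfloor>mat_trace a\<rfloor>) = 0"
  proof -
    have "real_of_int (\<Sum>a\<in>N. \<lfloor>mat_trace a\<rfloor>) = (\<Sum>a\<in>N. mat_trace a)"
      unfolding of_int_sum by (intro sum.cong refl fl)
    thus ?thesis using sum0 by (metis of_int_eq_0_iff)
  qed
  ultimately have "even (int n)" by (simp add: mat_trace_one) presburger
  thus False using odd_n by simp
qed

end

section \<open>Isotypic projections for normal subgroups of involutions\<close>

lemma involutions_commute:
  fixes a b :: "'a :: comm_ring_1 mat"
  assumes "a \<in> carrier_mat n n" "b \<in> carrier_mat n n" and "a * a = 1\<^sub>m n" "b * b = 1\<^sub>m n"
    and ab: "(a * b) * (a * b) = 1\<^sub>m n"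
  shows "a * b = b * a"
proof -
  have "a * b = a * ((a * b) * (a * b)) * b" using assms by simp
  also have "\<dots> = (a * a) * (b * a) * (b * b)" using assms(1,2) by (simp add: mat_mult_assoc_dim)
  also have "\<dots> = b * a" using assms by simp
  finally show ?thesis .
qed

text \<open>The inverse \<open>D'\<close> is a parameter because matrices of varying size carry no inverse operation.\<close>

definition normalizes :: "nat \<Rightarrow> real mat \<Rightarrow> real mat \<Rightarrow> real mat set \<Rightarrow> bool" where
  "normalizes n D D' E \<longleftrightarrow> D \<in> carrier_mat n n \<and> D' \<in> carrier_mat n n \<and>
     D * D' = 1\<^sub>m n \<and> D' * D = 1\<^sub>m n \<and> (\<forall>a\<in>E. D * a * D' \<in> E \<and> D' * a * D \<in> E)"

context odd_irreducible_matrix_group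
begin

text \<open>The normal subgroups of exponent at most two: every element is its own inverse.\<close>

definition normal_involutions :: "real mat set \<Rightarrow> bool" where
  "normal_involutions E \<longleftrightarrow> E \<subseteq> \<Gamma> \<and> 1\<^sub>m n \<in> E \<and> (\<forall>a\<in>E. \<forall>b\<in>E. a * b \<in> E) \<and> (\<forall>a\<in>E. a * a = 1\<^sub>m n) \<and>
     (\<forall>g\<in>\<Gamma>. \<forall>g'\<in>\<Gamma>. g * g' = 1\<^sub>m n \<longrightarrow> (\<forall>a\<in>E. g * a * g' \<in> E))"

lemma normal_involutionsD:
  assumes "normal_involutions E"
  shows "E \<subseteq> \<Gamma>" "1\<^sub>m n \<in> E" "\<And>a b. a \<in> E \<Longrightarrow> b \<in> E \<Longrightarrow> a * b \<in> E" "\<And>a. a \<in> E \<Longrightarrow> a * a = 1\<^sub>m n"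
    "\<And>g g' a. g \<in> \<Gamma> \<Longrightarrow> g' \<in> \<Gamma> \<Longrightarrow> g * g' = 1\<^sub>m n \<Longrightarrow> a \<in> E \<Longrightarrow> g * a * g' \<in> E"
    "\<And>a. a \<in> E \<Longrightarrow> a \<in> carrier_mat n n" "finite E"
  using assms group_carrier finite_subset[OF _ finite_group] unfolding normal_involutions_def by blast+

lemma normal_involutions_commute:
  assumes E: "normal_involutions E" and a: "a \<in> E" and b: "b \<in> E"
  shows "a * b = b * a"
  using normal_involutionsD(3,4,6)[OF E] a b by (intro involutions_commute) auto

lemma group_normalizes:
  assumes E: "normal_involutions E" and g: "g \<in> \<Gamma>" "g' \<in> \<Gamma>" "g * g' = 1\<^sub>m n"
  shows "normalizes n g g' E"
proof -
  have "g' * g = 1\<^sub>m n"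
    by (rule mat_mult_left_right_inverse[OF group_carrier[OF g(1)] group_carrier[OF g(2)] g(3)])
  thus ?thesis using g normal_involutionsD(5)[OF E] group_carrier by (auto simp: normalizes_def)
qed

text \<open>Starting from a vector negated by \<open>c\<close>, each further element \<open>a\<close> either negates the current vector
\<open>w\<close> already or fixes \<open>w + a w \<noteq> 0\<close>. By commutativity this replacement keeps the eigenvalues
that were arranged before.\<close>

lemma joint_eigenvector:
  assumes E: "normal_involutions E" and c: "c \<in> E" "c \<noteq> 1\<^sub>m n"
  obtains w where "w \<in> carrier_vec n" "w \<noteq> 0\<^sub>v n" "c *\<^sub>v w = (-1) \<cdot>\<^sub>v w"
    "\<And>a. a \<in> E \<Longrightarrow> \<exists>s. s * s = 1 \<and> a *\<^sub>v w = s \<cdot>\<^sub>v w"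
proof -
  note D = normal_involutionsD[OF E]
  have av: "a *\<^sub>v (b *\<^sub>v w) = (a * b) *\<^sub>v w" if "a \<in> E" "b \<in> E" "w \<in> carrier_vec n" for a b w
    using that D(6) by (intro assoc_mult_mat_vec[symmetric, of _ n n _ n]) auto
  have "\<exists>w. w \<in> carrier_vec n \<and> w \<noteq> 0\<^sub>v n \<and> c *\<^sub>v w = (-1) \<cdot>\<^sub>v w \<and> (\<forall>a\<in>F. \<exists>s. s * s = 1 \<and> a *\<^sub>v w = s \<cdot>\<^sub>v w)"
    if "finite F" "F \<subseteq> E" for F
    using that
  proof (induction F rule: finite_induct)
    case empty
    note cc = D(6)[OF c(1)]
    have "\<exists>u. u \<in> carrier_vec n \<and> c *\<^sub>v u \<noteq> u"
    proof (rule ccontr)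
      assume "\<not> ?thesis"
      hence "(c - 1\<^sub>m n) *\<^sub>v u = 0\<^sub>v n" if "u \<in> carrier_vec n" for u
        using that cc by (simp add: minus_mult_distrib_mat_vec[of _ n n])
      hence z: "c - 1\<^sub>m n = 0\<^sub>m n n" using mat_eq_0_if_mult_vec_eq_0[of "c - 1\<^sub>m n" n] by (simp add: minus_carrier_mat)
      have "c = 1\<^sub>m n"
      proof (rule eq_matI)
        fix i j assume ij: "i < dim_row (1\<^sub>m n :: real mat)" "j < dim_col (1\<^sub>m n :: real mat)"
        hence "(c - 1\<^sub>m n) $$ (i, j) = c $$ (i, j) - 1\<^sub>m n $$ (i, j)" using cc by simp
        thus "c $$ (i, j) = 1\<^sub>m n $$ (i, j)" unfolding z using ij by simp
      qed (use cc in auto)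
      thus False using c by simp
    qed
    then obtain u where u: "u \<in> carrier_vec n" "c *\<^sub>v u \<noteq> u" by blast
    define w where "w = c *\<^sub>v u + (-1) \<cdot>\<^sub>v u"
    have cu: "c *\<^sub>v u \<in> carrier_vec n" using cc u by simp
    have "c *\<^sub>v w = c *\<^sub>v (c *\<^sub>v u) + (-1) \<cdot>\<^sub>v (c *\<^sub>v u)"
      using cc u cu by (simp add: w_def mult_add_distrib_mat_vec[of _ n n] mult_mat_vec[of _ n n])
    also have "c *\<^sub>v (c *\<^sub>v u) = u" using av[OF c(1) c(1) u(1)] D(4)[OF c(1)] u by simp
    finally have "c *\<^sub>v w = (-1) \<cdot>\<^sub>v w" using u cu cc unfolding w_def by (intro eq_vecI) auto
    moreover have "w \<noteq> 0\<^sub>v n"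
    proof
      assume w0: "w = 0\<^sub>v n"
      have "c *\<^sub>v u = u"
      proof (rule eq_vecI)
        fix i assume i: "i < dim_vec u"
        have "w $ i = (c *\<^sub>v u) $ i - u $ i" using i u cu cc by (simp add: w_def)
        thus "(c *\<^sub>v u) $ i = u $ i" using w0 i u by simp
      qed (use u cc in auto)
      thus False using u by simp
    qed
    moreover have "w \<in> carrier_vec n" using u cu by (simp add: w_def)
    ultimately show ?case by blast
  next
    case (insert a F)
    then obtain w where w: "w \<in> carrier_vec n" "w \<noteq> 0\<^sub>v n" "c *\<^sub>v w = (-1) \<cdot>\<^sub>v w"
      and F: "\<And>b. b \<in> F \<Longrightarrow> \<exists>s. s * s = 1 \<and> b *\<^sub>v w = s \<cdot>\<^sub>v w" by auto
    have a: "a \<in> E" using insert by simp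
    note ac = D(6)[OF a]
    have aw: "a *\<^sub>v w \<in> carrier_vec n" using ac w by simp
    show ?case
    proof (cases "w + a *\<^sub>v w = 0\<^sub>v n")
      case True
      have "a *\<^sub>v w = (-1) \<cdot>\<^sub>v w"
      proof (rule eq_vecI)
        fix i assume i: "i < dim_vec ((-1) \<cdot>\<^sub>v w)"
        have "(w + a *\<^sub>v w) $ i = w $ i + (a *\<^sub>v w) $ i" using i w aw ac by simp
        thus "(a *\<^sub>v w) $ i = ((-1) \<cdot>\<^sub>v w) $ i" using i w unfolding True by simp
      qed (use w ac in auto)
      hence "\<exists>s. s * s = 1 \<and> a *\<^sub>v w = s \<cdot>\<^sub>v w" by (intro exI[of _ "-1"]) simp
      with w F show ?thesis by blast
    next
      case False
      define x where "x = w + a *\<^sub>v w"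
      have x: "x \<in> carrier_vec n" using w aw by (simp add: x_def)
      have key: "b *\<^sub>v x = s \<cdot>\<^sub>v x" if b: "b \<in> E" and bw: "b *\<^sub>v w = s \<cdot>\<^sub>v w" for b s
      proof -
        have "b *\<^sub>v (a *\<^sub>v w) = a *\<^sub>v (b *\<^sub>v w)"
          using av[OF a b w(1)] av[OF b a w(1)] normal_involutions_commute[OF E a b] by simp
        also have "\<dots> = s \<cdot>\<^sub>v (a *\<^sub>v w)" using bw ac w by (simp add: mult_mat_vec[of _ n n])
        finally show ?thesis
          using D(6)[OF b] w aw bw
          by (simp add: x_def mult_add_distrib_mat_vec[of _ n n] smult_add_distrib_vec[of _ n])
      qed
      have "a *\<^sub>v x = 1 \<cdot>\<^sub>v x"
        using ac w aw av[OF a a w(1)] D(4)[OF a]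
        by (simp add: x_def mult_add_distrib_mat_vec[of _ n n] comm_add_vec[of _ n])
      hence "\<exists>s. s * s = 1 \<and> a *\<^sub>v x = s \<cdot>\<^sub>v x" by (intro exI[of _ 1]) simp
      moreover have "\<exists>s. s * s = 1 \<and> b *\<^sub>v x = s \<cdot>\<^sub>v x" if "b \<in> F" for b
        using F[OF that] key[of b] that insert.prems by blast
      moreover have "c *\<^sub>v x = (-1) \<cdot>\<^sub>v x" by (rule key[OF c(1) w(3)])
      ultimately show ?thesis using x False unfolding x_def[symmetric] by blast
    qed
  qed
  from this[OF D(7) order_refl] show ?thesis using that by blast
qed

definition sign_character :: "real mat set \<Rightarrow> (real mat \<Rightarrow> real) \<Rightarrow> bool" where
  "sign_character E \<chi> \<longleftrightarrow> (\<forall>a\<in>E. \<chi> a * \<chi> a = 1) \<and> (\<forall>a\<in>E. \<forall>b\<in>E. \<chi> (a * b) = \<chi> a * \<chi> b)"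

text \<open>For a sign character this is the projection onto the common eigenspace
\<open>{v. \<forall>a\<in>E. a v = \<chi> a v}\<close> along the eigenspaces of the other characters.\<close>

definition isotypic_proj :: "real mat set \<Rightarrow> (real mat \<Rightarrow> real) \<Rightarrow> real mat" where
  "isotypic_proj E \<chi> = (1 / real (card E)) \<cdot>\<^sub>m msum n (\<lambda>a. \<chi> a \<cdot>\<^sub>m a) E"

lemma isotypic_proj_carrier [simp]: "isotypic_proj E \<chi> \<in> carrier_mat n n"
  by (simp add: isotypic_proj_def)

lemma isotypic_proj_cong: "(\<And>a. a \<in> E \<Longrightarrow> \<chi> a = \<psi> a) \<Longrightarrow> isotypic_proj E \<chi> = isotypic_proj E \<psi>"
  unfolding isotypic_proj_def by (intro arg_cong[where f = "\<lambda>M. _ \<cdot>\<^sub>m M"] msum_cong) auto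

lemma mult_isotypic_proj:
  assumes E: "normal_involutions E" and \<chi>: "sign_character E \<chi>" and b: "b \<in> E"
  shows "b * isotypic_proj E \<chi> = \<chi> b \<cdot>\<^sub>m isotypic_proj E \<chi>"
proof -
  note D = normal_involutionsD[OF E]
  note bc = D(6)[OF b]
  have bb: "b * (b * x) = x" if "x \<in> E" for x
    using D(6)[OF that] D(4)[OF b] bc by (simp flip: mat_mult_assoc_dim)
  have bij: "bij_betw (\<lambda>x. b * x) E E"
    by (rule bij_betw_byWitness[of _ "\<lambda>x. b * x"]) (use b D(3) bb in auto)
  have c1: "\<And>x. x \<in> E \<Longrightarrow> \<chi> x \<cdot>\<^sub>m x \<in> carrier_mat n n" using D(6) by simp
  have "b * msum n (\<lambda>x. \<chi> x \<cdot>\<^sub>m x) E = msum n (\<lambda>x. b * (\<chi> x \<cdot>\<^sub>m x)) E"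
    by (rule mult_msum[OF bc c1])
  also have "\<dots> = msum n (\<lambda>x. \<chi> b \<cdot>\<^sub>m (\<chi> (b * x) \<cdot>\<^sub>m (b * x))) E"
  proof (rule msum_cong[OF refl])
    fix x assume x: "x \<in> E"
    have "\<chi> b * \<chi> (b * x) = \<chi> x" using \<chi> x b by (simp add: sign_character_def flip: mult.assoc)
    thus "b * (\<chi> x \<cdot>\<^sub>m x) = \<chi> b \<cdot>\<^sub>m (\<chi> (b * x) \<cdot>\<^sub>m (b * x))"
      using D(6)[OF x] bc by (intro eq_matI) (auto simp flip: mult.assoc)
  qed
  also have "\<dots> = \<chi> b \<cdot>\<^sub>m msum n (\<lambda>x. \<chi> (b * x) \<cdot>\<^sub>m (b * x)) E"
    by (rule smult_msum[symmetric]) (use D(6) bc in auto)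
  also have "msum n (\<lambda>x. \<chi> (b * x) \<cdot>\<^sub>m (b * x)) E = msum n (\<lambda>x. \<chi> x \<cdot>\<^sub>m x) E"
    by (rule msum_reindex[OF bij])
  finally have "b * msum n (\<lambda>x. \<chi> x \<cdot>\<^sub>m x) E = \<chi> b \<cdot>\<^sub>m msum n (\<lambda>x. \<chi> x \<cdot>\<^sub>m x) E" .
  thus ?thesis
    unfolding isotypic_proj_def using bc
    by (simp add: mult_smult_distrib[of _ n n _ n]) (intro eq_matI, auto)
qed

lemma isotypic_proj_commute:
  assumes E: "normal_involutions E" and M: "M \<in> carrier_mat n n" and comm: "\<And>a. a \<in> E \<Longrightarrow> M * a = a * M"
  shows "M * isotypic_proj E \<chi> = isotypic_proj E \<chi> * M"
proof -
  have c1: "\<And>x. x \<in> E \<Longrightarrow> \<chi> x \<cdot>\<^sub>m x \<in> carrier_mat n n" using normal_involutionsD(6)[OF E] by simp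
  have "M * msum n (\<lambda>x. \<chi> x \<cdot>\<^sub>m x) E = msum n (\<lambda>x. M * (\<chi> x \<cdot>\<^sub>m x)) E"
    by (rule mult_msum[OF M c1])
  also have "\<dots> = msum n (\<lambda>x. (\<chi> x \<cdot>\<^sub>m x) * M) E"
  proof (rule msum_cong[OF refl])
    fix x assume x: "x \<in> E"
    show "M * (\<chi> x \<cdot>\<^sub>m x) = (\<chi> x \<cdot>\<^sub>m x) * M"
      using normal_involutionsD(6)[OF E x] M comm[OF x]
      by (simp add: mult_smult_distrib[of _ n n _ n] mult_smult_assoc_mat[of _ n n _ n])
  qed
  also have "\<dots> = msum n (\<lambda>x. \<chi> x \<cdot>\<^sub>m x) E * M" by (rule msum_mult[OF M c1, symmetric])
  finally show ?thesis unfolding isotypic_proj_def using M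
    by (simp add: mult_smult_distrib[of _ n n _ n] mult_smult_assoc_mat[of _ n n _ n])
qed

lemma isotypic_proj_idem:
  assumes E: "normal_involutions E" and \<chi>: "sign_character E \<chi>"
  shows "isotypic_proj E \<chi> * isotypic_proj E \<chi> = isotypic_proj E \<chi>"
proof -
  let ?P = "isotypic_proj E \<chi>"
  note D = normal_involutionsD[OF E]
  have "card E \<noteq> 0" using D(2,7) by auto
  have c1: "\<And>x. x \<in> E \<Longrightarrow> \<chi> x \<cdot>\<^sub>m x \<in> carrier_mat n n" using D(6) by simp
  have "msum n (\<lambda>x. \<chi> x \<cdot>\<^sub>m x) E * ?P = msum n (\<lambda>x. \<chi> x \<cdot>\<^sub>m x * ?P) E"
    by (rule msum_mult[OF _ c1]) simp_all
  also have "\<dots> = msum n (\<lambda>_. ?P) E"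
  proof (rule msum_cong[OF refl])
    fix x assume x: "x \<in> E"
    have "\<chi> x \<cdot>\<^sub>m x * ?P = \<chi> x \<cdot>\<^sub>m (\<chi> x \<cdot>\<^sub>m ?P)"
      using D(6)[OF x] mult_isotypic_proj[OF E \<chi> x] by (simp add: mult_smult_assoc_mat[of _ n n _ n])
    also have "\<dots> = ?P" using \<chi> x by (intro eq_matI) (auto simp: sign_character_def simp flip: mult.assoc)
    finally show "\<chi> x \<cdot>\<^sub>m x * ?P = ?P" .
  qed
  also have "\<dots> = real (card E) \<cdot>\<^sub>m ?P" by (rule msum_const) simp
  finally have *: "msum n (\<lambda>x. \<chi> x \<cdot>\<^sub>m x) E * ?P = real (card E) \<cdot>\<^sub>m ?P" .
  have "?P * ?P = (1 / real (card E)) \<cdot>\<^sub>m (msum n (\<lambda>x. \<chi> x \<cdot>\<^sub>m x) E * ?P)"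
    by (subst isotypic_proj_def) (simp add: mult_smult_assoc_mat[of _ n n _ n])
  also have "\<dots> = ?P" unfolding * using \<open>card E \<noteq> 0\<close> by (intro eq_matI) auto
  finally show ?thesis .
qed

text \<open>An element on which the two characters differ acts on the product of the projections by both of its
eigenvalues.\<close>

lemma isotypic_proj_orthogonal:
  assumes E: "normal_involutions E" and \<chi>: "sign_character E \<chi>" and \<psi>: "sign_character E \<psi>"
    and ne: "isotypic_proj E \<chi> \<noteq> isotypic_proj E \<psi>"
  shows "isotypic_proj E \<chi> * isotypic_proj E \<psi> = 0\<^sub>m n n"
proof -
  let ?P = "isotypic_proj E \<chi>" and ?R = "isotypic_proj E \<psi>"
  obtain b where b: "b \<in> E" "\<chi> b \<noteq> \<psi> b" using isotypic_proj_cong ne by blast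
  note D = normal_involutionsD[OF E]
  have bP: "b * ?P = ?P * b"
    by (rule isotypic_proj_commute[OF E D(6)[OF b(1)] normal_involutions_commute[OF E b(1)]])
  have "\<chi> b \<cdot>\<^sub>m (?P * ?R) = ?P * b * ?R"
    using mult_isotypic_proj[OF E \<chi> b(1)] bP by (simp flip: mult_smult_assoc_mat[of _ n n _ n])
  also have "\<dots> = ?P * (b * ?R)" using D(6)[OF b(1)] by (intro assoc_mult_mat[of _ n n _ n _ n]) auto
  also have "\<dots> = \<psi> b \<cdot>\<^sub>m (?P * ?R)"
    using mult_isotypic_proj[OF E \<psi> b(1)] by (simp add: mult_smult_distrib[of _ n n _ n])
  finally have eq: "\<chi> b \<cdot>\<^sub>m (?P * ?R) = \<psi> b \<cdot>\<^sub>m (?P * ?R)" .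
  have PR: "?P * ?R \<in> carrier_mat n n" by (rule mult_carrier_mat[of _ n n]) simp_all
  show ?thesis
  proof (rule eq_matI)
    fix i j assume "i < dim_row (0\<^sub>m n n :: real mat)" "j < dim_col (0\<^sub>m n n :: real mat)"
    hence ij: "i < n" "j < n" by auto
    have "(\<chi> b \<cdot>\<^sub>m (?P * ?R)) $$ (i, j) = \<chi> b * (?P * ?R) $$ (i, j)" using ij PR by (intro index_smult_mat) auto
    moreover have "(\<psi> b \<cdot>\<^sub>m (?P * ?R)) $$ (i, j) = \<psi> b * (?P * ?R) $$ (i, j)" using ij PR by (intro index_smult_mat) auto
    ultimately have "\<chi> b * (?P * ?R) $$ (i, j) = \<psi> b * (?P * ?R) $$ (i, j)" using eq by metis
    hence "(?P * ?R) $$ (i, j) = 0" using b(2) by (metis mult_right_cancel)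
    thus "(?P * ?R) $$ (i, j) = 0\<^sub>m n n $$ (i, j)" using ij by simp
  qed (use PR in auto)
qed

lemma conj_isotypic_proj:
  assumes E: "normal_involutions E" and \<chi>: "sign_character E \<chi>" and D: "normalizes n D D' E"
  shows "D * isotypic_proj E \<chi> * D' = isotypic_proj E (\<lambda>a. \<chi> (D' * a * D))"
    and "sign_character E (\<lambda>a. \<chi> (D' * a * D))"
proof -
  note N = normal_involutionsD[OF E]
  have Dc: "D \<in> carrier_mat n n" "D' \<in> carrier_mat n n" "D * D' = 1\<^sub>m n" "D' * D = 1\<^sub>m n"
    and DE: "\<And>a. a \<in> E \<Longrightarrow> D * a * D' \<in> E" "\<And>a. a \<in> E \<Longrightarrow> D' * a * D \<in> E"
    using D by (auto simp: normalizes_def)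
  have cancel: "D' * (D * x) = x" "D * (D' * x) = x" if "x \<in> carrier_mat n n" for x
    using Dc that by (simp_all flip: mat_mult_assoc_dim)
  have DD: "D' * (D * x * D') * D = x" "D * (D' * x * D) * D' = x" if "x \<in> E" for x
    using Dc N(6)[OF that] cancel by (simp_all add: mat_mult_assoc_dim)
  have bij: "bij_betw (\<lambda>x. D * x * D') E E"
    by (rule bij_betw_byWitness[of _ "\<lambda>x. D' * x * D"]) (use DE DD in auto)
  have c1: "\<And>x. x \<in> E \<Longrightarrow> \<chi> x \<cdot>\<^sub>m x \<in> carrier_mat n n" using N(6) by simp
  have "D * msum n (\<lambda>x. \<chi> x \<cdot>\<^sub>m x) E * D' = msum n (\<lambda>x. D * (\<chi> x \<cdot>\<^sub>m x) * D') E"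
    using c1 Dc by (simp add: mult_msum msum_mult)
  also have "\<dots> = msum n (\<lambda>x. \<chi> (D' * (D * x * D') * D) \<cdot>\<^sub>m (D * x * D')) E"
  proof (rule msum_cong[OF refl])
    fix x assume x: "x \<in> E"
    show "D * (\<chi> x \<cdot>\<^sub>m x) * D' = \<chi> (D' * (D * x * D') * D) \<cdot>\<^sub>m (D * x * D')"
      unfolding DD(1)[OF x] using N(6)[OF x] Dc
      by (simp add: mult_smult_distrib[of _ n n _ n] mult_smult_assoc_mat[of _ n n _ n])
  qed
  also have "\<dots> = msum n (\<lambda>x. \<chi> (D' * x * D) \<cdot>\<^sub>m x) E"
    by (rule msum_reindex[OF bij, of n "\<lambda>x. \<chi> (D' * x * D) \<cdot>\<^sub>m x"])
  finally show "D * isotypic_proj E \<chi> * D' = isotypic_proj E (\<lambda>a. \<chi> (D' * a * D))"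
    unfolding isotypic_proj_def using Dc
    by (simp add: mult_smult_distrib[of _ n n _ n] mult_smult_assoc_mat[of _ n n _ n])
  have "D' * (a * b) * D = (D' * a * D) * (D' * b * D)" if "a \<in> E" "b \<in> E" for a b
    using Dc N(6)[OF that(1)] N(6)[OF that(2)] cancel by (simp add: mat_mult_assoc_dim)
  thus "sign_character E (\<lambda>a. \<chi> (D' * a * D))"
    using \<chi> DE(2) unfolding sign_character_def by simp
qed

lemma isotypic_proj_fixes:
  assumes E: "normal_involutions E" and w: "w \<in> carrier_vec n"
    and eig: "\<And>a. a \<in> E \<Longrightarrow> \<chi> a * \<chi> a = 1 \<and> a *\<^sub>v w = \<chi> a \<cdot>\<^sub>v w"
  shows "isotypic_proj E \<chi> *\<^sub>v w = w"
proof -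
  note N = normal_involutionsD[OF E]
  have c1: "\<And>x. x \<in> E \<Longrightarrow> \<chi> x \<cdot>\<^sub>m x \<in> carrier_mat n n" using N(6) by simp
  have card: "card E \<noteq> 0" using N(2,7) by auto
  have each: "(\<chi> a \<cdot>\<^sub>m a) *\<^sub>v w = w" if a: "a \<in> E" for a
    using eig[OF a] w smult_mat_mult_vec[OF N(6)[OF a] w, of "\<chi> a"] by (simp add: smult_smult_assoc)
  have "msum n (\<lambda>a. \<chi> a \<cdot>\<^sub>m a) E *\<^sub>v w = real (card E) \<cdot>\<^sub>v w"
  proof (rule eq_vecI)
    fix i assume "i < dim_vec (real (card E) \<cdot>\<^sub>v w)"
    hence i: "i < n" using w by simp
    have "(msum n (\<lambda>a. \<chi> a \<cdot>\<^sub>m a) E *\<^sub>v w) $ i = (\<Sum>a\<in>E. w $ i)"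
      by (subst msum_mult_vec_index[OF w c1 i]) (auto simp: each intro!: sum.cong)
    thus "(msum n (\<lambda>a. \<chi> a \<cdot>\<^sub>m a) E *\<^sub>v w) $ i = (real (card E) \<cdot>\<^sub>v w) $ i" using i w by simp
  qed (use w in auto)
  thus ?thesis
    unfolding isotypic_proj_def using w card
    by (subst smult_mat_mult_vec[of _ n n]) (auto simp: smult_smult_assoc)
qed

end

text \<open>Since \<open>C M B\<close> is the restriction of \<open>M\<close> to the image of \<open>B C\<close>, restriction is multiplicative
as soon as the left factor preserves the decomposition.\<close>

lemma compress_mult:
  fixes M N B C :: "'a :: comm_ring_1 mat"
  assumes BC: "B \<in> carrier_mat n d" "C \<in> carrier_mat d n" "C * B = 1\<^sub>m d"
    and M: "M \<in> carrier_mat n n" "M * (B * C) = B * C * M" and N: "N \<in> carrier_mat n n"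
  shows "(C * M * B) * (C * N * B) = C * (M * N) * B"
proof -
  have "(C * M * B) * (C * N * B) = C * (M * (B * C)) * (N * B)"
    using BC(1,2) M(1) N by (simp add: mat_mult_assoc_dim)
  also have "\<dots> = (C * B) * (C * M * (N * B))"
    unfolding M(2) using BC(1,2) M(1) N by (simp add: mat_mult_assoc_dim)
  also have "\<dots> = C * (M * N) * B"
  proof -
    have "C * M * (N * B) \<in> carrier_mat d d" using BC(1,2) M(1) N by (intro mult_carrier_mat) auto
    hence "1\<^sub>m d * (C * M * (N * B)) = C * M * (N * B)" by (rule left_mult_one_mat)
    also have "\<dots> = C * (M * N) * B"
      using BC(1,2) M(1) N by (simp add: mat_mult_assoc_dim)
    finally show ?thesis unfolding BC(3) .
  qed
  finally show ?thesis .
qed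

context odd_irreducible_matrix_group
begin

text \<open>The key to every later argument: a common eigenspace of \<open>E\<close> of odd dimension \<open>d\<close> on which \<open>c\<close>
is \<open>-1\<close>, in the form of a factored projection \<open>P = B C\<close>. Take the character \<open>\<chi>\<close> of a joint
eigenvector \<open>w\<close>. The conjugates of \<open>P\<close> under the group are pairwise orthogonal and their sum \<open>Q\<close>
commutes with the group and fixes \<open>w\<close>, so \<open>Q = 1\<close>. Comparing traces, \<open>n\<close> is the number of
conjugates times \<open>d\<close>. As the conjugates add up to the identity, they are all the non-zero
isotypic projections; so conjugation by a matrix \<open>D\<close> normalizing \<open>E\<close> takes \<open>P\<close> to a conjugate
of \<open>P\<close> under the group, and correcting \<open>D\<close> by a group element makes it commute with \<open>P\<close>.\<close>

lemma odd_rank_isotypic_component: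
  assumes E: "normal_involutions E" and c: "c \<in> E" "c \<noteq> 1\<^sub>m n"
  obtains d B C where "odd d" "B \<in> carrier_mat n d" "C \<in> carrier_mat d n" "C * B = 1\<^sub>m d"
    "c * (B * C) = (-1) \<cdot>\<^sub>m (B * C)"
    "\<And>M. M \<in> carrier_mat n n \<Longrightarrow> (\<And>a. a \<in> E \<Longrightarrow> M * a = a * M) \<Longrightarrow> M * (B * C) = B * C * M"
    "\<And>D D'. normalizes n D D' E \<Longrightarrow> \<exists>g\<in>\<Gamma>. (g * D) * (B * C) = B * C * (g * D)"
proof -
  note N = normal_involutionsD[OF E]
  obtain w where w: "w \<in> carrier_vec n" "w \<noteq> 0\<^sub>v n" "c *\<^sub>v w = (-1) \<cdot>\<^sub>v w"
    and eig: "\<And>a. a \<in> E \<Longrightarrow> \<exists>s. s * s = 1 \<and> a *\<^sub>v w = s \<cdot>\<^sub>v w"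
    using joint_eigenvector[OF E c] by blast
  obtain \<chi> where \<chi>: "\<And>a. a \<in> E \<Longrightarrow> \<chi> a * \<chi> a = 1 \<and> a *\<^sub>v w = \<chi> a \<cdot>\<^sub>v w"
    using eig by metis
  have inj: "s = t" if "s \<cdot>\<^sub>v w = t \<cdot>\<^sub>v w" for s t :: real
  proof -
    obtain i where i: "i < n" "w $ i \<noteq> 0" using w by (metis carrier_vecD eq_vecI index_zero_vec)
    have "(s \<cdot>\<^sub>v w) $ i = (t \<cdot>\<^sub>v w) $ i" by (simp only: that)
    thus ?thesis using i w by simp
  qed
  have char: "sign_character E \<chi>"
    unfolding sign_character_def
  proof (intro conjI ballI)
    fix a b assume a: "a \<in> E" and b: "b \<in> E"
    have "\<chi> (a * b) \<cdot>\<^sub>v w = (a * b) *\<^sub>v w" using \<chi>[OF N(3)[OF a b]] by simp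
    also have "\<dots> = a *\<^sub>v (b *\<^sub>v w)" using N(6)[OF a] N(6)[OF b] w by (intro assoc_mult_mat_vec[of _ n n _ n]) auto
    also have "\<dots> = (\<chi> b * \<chi> a) \<cdot>\<^sub>v w"
      using \<chi>[OF a] \<chi>[OF b] N(6)[OF a] w by (simp add: mult_mat_vec[of _ n n] smult_smult_assoc)
    finally show "\<chi> (a * b) = \<chi> a * \<chi> b" by (intro inj) (simp add: mult.commute)
  qed (use \<chi> in auto)
  have \<chi>c: "\<chi> c = -1" using \<chi>[OF c(1)] w(3) by (intro inj) simp
  define P where "P = isotypic_proj E \<chi>"
  have P: "P \<in> carrier_mat n n" by (simp add: P_def)
  have idem: "P * P = P" unfolding P_def by (rule isotypic_proj_idem[OF E char])
  have Pw: "P *\<^sub>v w = w" unfolding P_def 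
  proof (rule isotypic_proj_fixes[OF E w(1)])
    fix a assume "a \<in> E"
    thus "\<chi> a * \<chi> a = 1 \<and> a *\<^sub>v w = \<chi> a \<cdot>\<^sub>v w" by (rule \<chi>)
  qed
  obtain d B C where BC: "B \<in> carrier_mat n d" "C \<in> carrier_mat d n" "P = B * C" "C * B = 1\<^sub>m d"
    by (rule idempotent_rank_factorization[OF P idem])
  have trP: "mat_trace P = real d"
    unfolding BC(3) mat_trace_mult_comm[OF BC(1,2)] BC(4) by (simp add: mat_trace_one)

  \<comment> \<open>The orbit is taken as a set of matrices, so that characters with the same projection count once.\<close>
  define X where "X = {g * P * g' | g g'. g \<in> \<Gamma> \<and> g' \<in> \<Gamma> \<and> g * g' = 1\<^sub>m n}"
  define Q where "Q = msum n (\<lambda>R. R) X"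
  have "X \<subseteq> (\<lambda>(g, g'). g * P * g') ` (\<Gamma> \<times> \<Gamma>)" by (auto simp: X_def)
  hence finX: "finite X" using finite_group finite_subset by blast
  have X_proj: "\<exists>\<psi>. sign_character E \<psi> \<and> R = isotypic_proj E \<psi>" if RX: "R \<in> X" for R
  proof -
    obtain g g' where g: "g \<in> \<Gamma>" "g' \<in> \<Gamma>" "g * g' = 1\<^sub>m n" and R: "R = g * P * g'"
      using RX unfolding X_def by blast
    show ?thesis
      using conj_isotypic_proj[OF E char group_normalizes[OF E g]] unfolding R P_def by blast
  qed
  have Xc: "R \<in> carrier_mat n n" if "R \<in> X" for R using X_proj[OF that] by fastforce
  have Q: "Q \<in> carrier_mat n n" by (simp add: Q_def)
  have PX: "P \<in> X"
    unfolding X_def using one_in_group P by (intro CollectI exI[of _ "1\<^sub>m n"]) simp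
  have orth: "R * R' = 0\<^sub>m n n"
    if "\<exists>\<psi>. sign_character E \<psi> \<and> R = isotypic_proj E \<psi>" "R' \<in> X" "R \<noteq> R'" for R R'
    using that(1,3) X_proj[OF that(2)] isotypic_proj_orthogonal[OF E] by blast
  have gX: "a * R * b \<in> X" if a: "a \<in> \<Gamma>" and b: "b \<in> \<Gamma>" and ab: "a * b = 1\<^sub>m n" and R: "R \<in> X" for a b R
  proof -
    obtain x x' where x: "x \<in> \<Gamma>" "x' \<in> \<Gamma>" "x * x' = 1\<^sub>m n" "R = x * P * x'"
      using R unfolding X_def by blast
    note cs = group_carrier[OF a] group_carrier[OF b] group_carrier[OF x(1)] group_carrier[OF x(2)]
    have "a * R * b = (a * x) * P * (x' * b)"
      unfolding x(4) using cs P by (simp add: mat_mult_assoc_dim)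
    moreover have "(a * x) * (x' * b) = a * (x * x') * b"
      using cs by (simp add: mat_mult_assoc_dim)
    hence "(a * x) * (x' * b) = 1\<^sub>m n" using x(3) ab cs by simp
    ultimately show ?thesis using a b x mult_in_group unfolding X_def by blast
  qed
  have comm: "Q * g = g * Q" if "g \<in> \<Gamma>" for g
    unfolding Q_def using Xc gX that by (rule conj_invariant_sum_commutes)
  have "Q * P = msum n (\<lambda>R. R * P) X" unfolding Q_def by (rule msum_mult[OF P Xc])
  also have "\<dots> = msum n (\<lambda>R. if R = P then P else 0\<^sub>m n n) X"
    using X_proj PX by (intro msum_cong refl) (auto simp: idem intro!: orth)
  also have "\<dots> = P" by (rule msum_delta[OF finX PX P])
  finally have QP: "Q * P = P" .
  have "Q *\<^sub>v w = (Q * P) *\<^sub>v w"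
    using Q P w Pw by (simp add: assoc_mult_mat_vec[of _ n n _ n])
  hence "Q *\<^sub>v w = 1 \<cdot>\<^sub>v w" unfolding QP Pw by simp
  hence "Q = 1 \<cdot>\<^sub>m 1\<^sub>m n" using commutant_scalar_if_eigenvector[OF Q comm w(1,2)] by blast
  hence Q1: "Q = 1\<^sub>m n" by auto
  have trR: "mat_trace R = real d" if R: "R \<in> X" for R
  proof -
    obtain x x' where x: "x \<in> \<Gamma>" "x' \<in> \<Gamma>" "x * x' = 1\<^sub>m n" "R = x * P * x'"
      using R unfolding X_def by blast
    note cs = group_carrier[OF x(1)] group_carrier[OF x(2)]
    have x'x: "x' * x = 1\<^sub>m n" by (rule mat_mult_left_right_inverse[OF cs x(3)])
    have "mat_trace R = mat_trace (x' * (x * P))"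
      unfolding x(4) using mat_trace_mult_comm[of "x * P" n n x'] cs P by simp
    also have "x' * (x * P) = P" using x'x cs P by (simp flip: mat_mult_assoc_dim)
    finally show ?thesis using trP by simp
  qed
  have "real n = mat_trace Q" by (simp add: Q1 mat_trace_one)
  also have "\<dots> = (\<Sum>R\<in>X. mat_trace R)" unfolding Q_def by (rule mat_trace_msum[OF Xc])
  also have "\<dots> = real (card X * d)" using trR by simp
  finally have "n = card X * d" using of_nat_eq_iff by blast
  hence odd: "odd d" using odd_n by simp

  have "c * P = (-1) \<cdot>\<^sub>m P" using mult_isotypic_proj[OF E char c(1)] \<chi>c by (simp add: P_def)
  moreover have "M * P = P * M" if "M \<in> carrier_mat n n" "\<And>a. a \<in> E \<Longrightarrow> M * a = a * M" for M
    unfolding P_def by (rule isotypic_proj_commute[OF E that])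
  moreover have "\<exists>g\<in>\<Gamma>. (g * D) * P = P * (g * D)" if D: "normalizes n D D' E" for D D'
  proof -
    define R where "R = D * P * D'"
    have Dc: "D \<in> carrier_mat n n" "D' \<in> carrier_mat n n" "D * D' = 1\<^sub>m n" "D' * D = 1\<^sub>m n"
      using D by (auto simp: normalizes_def)
    have Rc: "R \<in> carrier_mat n n" using Dc P by (simp add: R_def)
    have Rproj: "\<exists>\<psi>. sign_character E \<psi> \<and> R = isotypic_proj E \<psi>"
      using conj_isotypic_proj[OF E char D] unfolding R_def P_def by blast
    have RD: "R * D = D * P" using Dc P by (simp add: R_def mat_mult_assoc_dim)
    have "R \<in> X"
    proof (rule ccontr)
      assume nX: "R \<notin> X"
      have "R = R * Q" using Rc Q1 by simp
      also have "\<dots> = msum n (\<lambda>R'. R * R') X" unfolding Q_def by (rule mult_msum[OF Rc Xc])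
      also have "\<dots> = msum n (\<lambda>R'. 0\<^sub>m n n) X"
        using nX orth[OF Rproj] by (intro msum_cong refl) blast
      also have "\<dots> = 0\<^sub>m n n" by (intro eq_matI) (auto simp: msum_def)
      finally have "D * P = 0\<^sub>m n n" using RD Dc by simp
      hence "D' * (D * P) = 0\<^sub>m n n" using Dc by simp
      hence "P = 0\<^sub>m n n" using Dc P by (simp flip: mat_mult_assoc_dim)
      hence "P *\<^sub>v w = 0\<^sub>v n" using w(1) by (intro eq_vecI) auto
      thus False using Pw w(2) by simp
    qed
    then obtain g g' where g: "g \<in> \<Gamma>" "g' \<in> \<Gamma>" "g * g' = 1\<^sub>m n" and Rg: "R = g * P * g'"
      unfolding X_def by blast
    note gc = group_carrier[OF g(1)] group_carrier[OF g(2)]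
    have g'g: "g' * g = 1\<^sub>m n" by (rule mat_mult_left_right_inverse[OF gc g(3)])
    have "(g' * D) * P = g' * (R * D)" using gc Dc P RD by (simp add: mat_mult_assoc_dim)
    also have "\<dots> = (g' * g) * (P * (g' * D))"
      unfolding Rg using gc Dc P by (simp add: mat_mult_assoc_dim)
    also have "\<dots> = P * (g' * D)" using g'g gc Dc P by simp
    finally show ?thesis using g(2) by blast
  qed
  ultimately show ?thesis using that[OF odd BC(1,2,4)] unfolding BC(3) by blast
qed

text \<open>The commutator \<open>c = abab\<close> of two elements lies in \<open>A \<inter> A'\<close>. If it were not \<open>1\<close>, it would be
\<open>-1\<close> on an odd-dimensional isotypic component of \<open>A \<inter> A'\<close>. Both \<open>a\<close> and \<open>b\<close> commute with
\<open>A \<inter> A'\<close> and therefore preserve this component, where \<open>(ab)\<^sup>2 = -1\<close>. But \<open>-1\<close> has determinant \<open>-1\<close>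
in odd dimension, which is not a square.\<close>

lemma normal_involutions_elementwise_commute:
  assumes A: "normal_involutions A" and A': "normal_involutions A'" and a: "a \<in> A" and b: "b \<in> A'"
  shows "a * b = b * a"
proof -
  note N = normal_involutionsD[OF A] and N' = normal_involutionsD[OF A']
  note ac = N(6)[OF a] and bc = N'(6)[OF b]
  have aG: "a \<in> \<Gamma>" and bG: "b \<in> \<Gamma>" using subsetD[OF N(1) a] subsetD[OF N'(1) b] .
  define c where "c = (a * b) * (a * b)"
  have E: "normal_involutions (A \<inter> A')"
    using N(1-5) N'(1-5) unfolding normal_involutions_def by (simp add: le_infI1)
  have "a * (b * a * b) \<in> A" by (rule N(3)[OF a N(5)[OF bG bG N'(4)[OF b] a]])
  moreover have "(a * b * a) * b \<in> A'" by (rule N'(3)[OF N'(5)[OF aG aG N(4)[OF a] b] b])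
  ultimately have cE: "c \<in> A \<inter> A'" using ac bc by (simp add: c_def mat_mult_assoc_dim)
  have c1: "c = 1\<^sub>m n"
  proof (rule ccontr)
    assume "c \<noteq> 1\<^sub>m n"
    from odd_rank_isotypic_component[OF E cE this]
    obtain d B C where d: "odd d" and BC: "B \<in> carrier_mat n d" "C \<in> carrier_mat d n" "C * B = 1\<^sub>m d"
      and cP: "c * (B * C) = (-1) \<cdot>\<^sub>m (B * C)"
      and comm: "\<And>M. M \<in> carrier_mat n n \<Longrightarrow> (\<And>a. a \<in> A \<inter> A' \<Longrightarrow> M * a = a * M) \<Longrightarrow> M * (B * C) = B * C * M"
      by metis
    have Pa: "a * (B * C) = B * C * a"
      by (rule comm[OF ac]) (use normal_involutions_commute[OF A a] in blast)
    have Pb: "b * (B * C) = B * C * b"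
      by (rule comm[OF bc]) (use normal_involutions_commute[OF A' b] in blast)
    have Pab: "(a * b) * (B * C) = B * C * (a * b)"
    proof -
      have "(a * b) * (B * C) = a * (b * (B * C))" using ac bc BC(1,2) by (simp add: mat_mult_assoc_dim)
      also have "\<dots> = (a * (B * C)) * b" unfolding Pb using ac bc BC(1,2) by (simp add: mat_mult_assoc_dim)
      also have "\<dots> = B * C * (a * b)" unfolding Pa using ac bc BC(1,2) by (simp add: mat_mult_assoc_dim)
      finally show ?thesis .
    qed
    have ab: "a * b \<in> carrier_mat n n" using ac bc by simp
    have cc: "c \<in> carrier_mat n n" using ab by (simp add: c_def)
    define x where "x = C * (a * b) * B"
    have x: "x \<in> carrier_mat d d" using BC ab by (simp add: x_def)
    have "x * x = C * c * B"
      unfolding x_def c_def by (rule compress_mult[OF BC ab Pab ab])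
    also have "C * c * B = C * (c * (B * C)) * B"
    proof -
      have "C * (c * (B * C)) * B = C * c * (B * (C * B))" using BC(1,2) cc by (simp add: mat_mult_assoc_dim)
      also have "\<dots> = C * c * B" unfolding BC(3) using BC(1) by simp
      finally show ?thesis ..
    qed
    also have "\<dots> = (-1) \<cdot>\<^sub>m (C * (B * C) * B)"
      unfolding cP using BC(1,2)
      by (simp add: mult_smult_distrib[of _ d n _ n] mult_smult_assoc_mat[of _ d n _ d])
    also have "C * (B * C) * B = (C * B) * (C * B)" using BC(1,2) by (simp add: mat_mult_assoc_dim)
    also have "\<dots> = 1\<^sub>m d" unfolding BC(3) by simp
    finally have "det (x * x) = (-1) ^ d" by simp
    moreover have "det (x * x) = det x * det x" by (rule det_mult[OF x x])
    ultimately have "det x * det x = -1" using d by simp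
    thus False using zero_le_square[of "det x"] by linarith
  qed
  show ?thesis
    by (rule involutions_commute[OF ac bc N(4)[OF a] N'(4)[OF b] c1[unfolded c_def]])
qed

section \<open>The union of all normal subgroups of involutions\<close>

lemma normal_involutions_prod:
  assumes A: "normal_involutions A" and B: "normal_involutions B"
  shows "normal_involutions {a * b | a b. a \<in> A \<and> b \<in> B}" (is "normal_involutions ?P")
proof -
  note N = normal_involutionsD[OF A] and N' = normal_involutionsD[OF B]
  have mul: "(a * b) * (a' * b') = (a * a') * (b * b')"
    if "a \<in> A" "b \<in> B" "a' \<in> A" "b' \<in> B" for a b a' b'
  proof -
    note cs = N(6)[OF that(1)] N'(6)[OF that(2)] N(6)[OF that(3)] N'(6)[OF that(4)]
    have "(a * b) * (a' * b') = a * (b * a') * b'" using cs by (simp add: mat_mult_assoc_dim)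
    also have "b * a' = a' * b"
      using normal_involutions_elementwise_commute[OF A B that(3,2)] by simp
    finally show ?thesis using cs by (simp add: mat_mult_assoc_dim)
  qed
  show ?thesis
    unfolding normal_involutions_def
  proof (intro conjI ballI impI)
    show "?P \<subseteq> \<Gamma>" using N(1) N'(1) mult_in_group by blast
    have "1\<^sub>m n = 1\<^sub>m n * (1\<^sub>m n :: real mat)" by simp
    thus "1\<^sub>m n \<in> ?P" using N(2) N'(2) by blast
  next
    fix x y assume "x \<in> ?P" "y \<in> ?P"
    then obtain a b a' b' where ab: "a \<in> A" "b \<in> B" "a' \<in> A" "b' \<in> B" "x = a * b" "y = a' * b'" by blast
    show "x * y \<in> ?P" unfolding ab(5,6) mul[OF ab(1-4)] using N(3) N'(3) ab(1-4) by blast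
  next
    fix x assume "x \<in> ?P"
    then obtain a b where ab: "a \<in> A" "b \<in> B" "x = a * b" by blast
    show "x * x = 1\<^sub>m n" unfolding ab(3) mul[OF ab(1,2,1,2)] using N(4) N'(4) ab by simp
  next
    fix g g' x assume g: "g \<in> \<Gamma>" "g' \<in> \<Gamma>" "g * g' = 1\<^sub>m n" and "x \<in> ?P"
    then obtain a b where ab: "a \<in> A" "b \<in> B" "x = a * b" by blast
    note cs = N(6)[OF ab(1)] N'(6)[OF ab(2)] group_carrier[OF g(1)] group_carrier[OF g(2)]
    have g'g: "g' * g = 1\<^sub>m n" by (rule mat_mult_left_right_inverse[OF cs(3,4) g(3)])
    have "(g * a * g') * (g * b * g') = g * a * (g' * g) * b * g'" using cs by (simp add: mat_mult_assoc_dim)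
    also have "\<dots> = g * x * g'" unfolding g'g ab(3) using cs by (simp add: mat_mult_assoc_dim)
    finally have "g * x * g' = (g * a * g') * (g * b * g')" ..
    thus "g * x * g' \<in> ?P" using N(5)[OF g ab(1)] N'(5)[OF g ab(2)] by blast
  qed
qed

text \<open>A single normal subgroup of exponent two need not be preserved by a matrix normalizing \<open>\<Gamma>\<close>, but the
union of all of them is. It is closed under multiplication because any two of them commute
elementwise, so that their product is again of this kind.\<close>

definition involution_core :: "real mat set" where
  "involution_core = \<Union>{A. normal_involutions A}"

lemma normal_involutions_core: "normal_involutions involution_core"
  unfolding normal_involutions_def
proof (intro conjI ballI impI)
  have "g * 1\<^sub>m n * g' = g * g'" if "g \<in> \<Gamma>" for g g'
    using group_carrier[OF that] by simp
  hence "normal_involutions {1\<^sub>m n}"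
    using one_in_group by (auto simp: normal_involutions_def)
  thus "1\<^sub>m n \<in> involution_core" by (auto simp: involution_core_def)
  show "involution_core \<subseteq> \<Gamma>" using normal_involutionsD(1) by (auto simp: involution_core_def)
next
  fix x y assume "x \<in> involution_core" "y \<in> involution_core"
  then obtain A B where AB: "normal_involutions A" "normal_involutions B" "x \<in> A" "y \<in> B"
    by (auto simp: involution_core_def)
  have "x * y \<in> {a * b | a b. a \<in> A \<and> b \<in> B}" using AB(3,4) by blast
  thus "x * y \<in> involution_core"
    unfolding involution_core_def using normal_involutions_prod[OF AB(1,2)] by blast
next
  fix x assume "x \<in> involution_core"
  thus "x * x = 1\<^sub>m n" using normal_involutionsD(4) by (auto simp: involution_core_def)
next
  fix g g' x assume "g \<in> \<Gamma>" "g' \<in> \<Gamma>" "g * g' = 1\<^sub>m n" "x \<in> involution_core"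
  thus "g * x * g' \<in> involution_core"
    using normal_involutionsD(5) unfolding involution_core_def by blast
qed

lemma normalizes_sym: "normalizes n D D' S \<Longrightarrow> normalizes n D' D S"
  by (auto simp: normalizes_def)

lemma normal_involutions_conj:
  assumes D: "normalizes n D D' \<Gamma>" and A: "normal_involutions A"
  shows "normal_involutions ((\<lambda>a. D * a * D') ` A)"
proof -
  note N = normal_involutionsD[OF A]
  have Dc: "D \<in> carrier_mat n n" "D' \<in> carrier_mat n n" "D * D' = 1\<^sub>m n" "D' * D = 1\<^sub>m n"
    and DG: "\<And>a. a \<in> \<Gamma> \<Longrightarrow> D * a * D' \<in> \<Gamma>" "\<And>a. a \<in> \<Gamma> \<Longrightarrow> D' * a * D \<in> \<Gamma>"
    using D by (auto simp: normalizes_def)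
  have cancel: "D' * (D * x) = x" "D * (D' * x) = x" if "x \<in> carrier_mat n n" for x
    using Dc that by (simp_all flip: mat_mult_assoc_dim)
  have mul: "(D * a * D') * (D * b * D') = D * (a * b) * D'"
    if "a \<in> carrier_mat n n" "b \<in> carrier_mat n n" for a b
    using Dc that cancel by (simp add: mat_mult_assoc_dim)
  show ?thesis
    unfolding normal_involutions_def
  proof (intro conjI ballI impI)
    show "(\<lambda>a. D * a * D') ` A \<subseteq> \<Gamma>" using DG N(1) by blast
    show "1\<^sub>m n \<in> (\<lambda>a. D * a * D') ` A"
      using Dc N(2) by (intro image_eqI[of _ _ "1\<^sub>m n"]) auto
  next
    fix x y assume "x \<in> (\<lambda>a. D * a * D') ` A" "y \<in> (\<lambda>a. D * a * D') ` A"
    then obtain a b where ab: "a \<in> A" "b \<in> A" "x = D * a * D'" "y = D * b * D'" by blast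
    show "x * y \<in> (\<lambda>a. D * a * D') ` A"
      unfolding ab(3,4) mul[OF N(6)[OF ab(1)] N(6)[OF ab(2)]] using N(3)[OF ab(1,2)] by blast
  next
    fix x assume "x \<in> (\<lambda>a. D * a * D') ` A"
    then obtain a where a: "a \<in> A" "x = D * a * D'" by blast
    show "x * x = 1\<^sub>m n"
      unfolding a(2) mul[OF N(6)[OF a(1)] N(6)[OF a(1)]] N(4)[OF a(1)] using Dc by simp
  next
    fix g g' x assume g: "g \<in> \<Gamma>" "g' \<in> \<Gamma>" "g * g' = 1\<^sub>m n" and "x \<in> (\<lambda>a. D * a * D') ` A"
    then obtain a where a: "a \<in> A" "x = D * a * D'" by blast
    note cs = group_carrier[OF g(1)] group_carrier[OF g(2)] N(6)[OF a(1)] Dc(1,2)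
    have "(D' * g * D) * (D' * g' * D) = D' * (g * g') * D"
      using cs cancel by (simp add: mat_mult_assoc_dim)
    also have "\<dots> = 1\<^sub>m n" unfolding g(3) using Dc by simp
    finally have "(D' * g * D) * a * (D' * g' * D) \<in> A"
      by (intro N(5) DG g a)
    moreover have "D * ((D' * g * D) * a * (D' * g' * D)) * D' = g * x * g'"
      unfolding a(2) using cs cancel Dc by (simp add: mat_mult_assoc_dim)
    ultimately show "g * x * g' \<in> (\<lambda>a. D * a * D') ` A" by (metis image_eqI)
  qed
qed

lemma normalizes_core:
  assumes D: "normalizes n D D' \<Gamma>"
  shows "normalizes n D D' involution_core"
proof -
  have "D * a * D' \<in> involution_core" if "normalizes n D D' \<Gamma>" "a \<in> involution_core" for D D' a
    using that(2) normal_involutions_conj[OF that(1)] unfolding involution_core_def by blast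
  from this[OF D] this[OF normalizes_sym[OF D]] show ?thesis using D by (auto simp: normalizes_def)
qed

end

section \<open>Matrices normalizing the group\<close>

lemma det_power_mat:
  fixes M :: "'a :: comm_ring_1 mat"
  assumes M: "M \<in> carrier_mat n n" shows "det (M ^\<^sub>m k) = det M ^ k"
  by (induction k) (use M in \<open>auto simp: det_mult[of _ n]\<close>)

lemma power_mat_eigenvector:
  fixes M :: "'a :: field mat"
  assumes M: "M \<in> carrier_mat n n" and v: "v \<in> carrier_vec n" and eig: "M *\<^sub>v v = l \<cdot>\<^sub>v v"
  shows "(M ^\<^sub>m k) *\<^sub>v v = l ^ k \<cdot>\<^sub>v v"
proof (induction k)
  case (Suc k)
  have "(M ^\<^sub>m k * M) *\<^sub>v v = (M ^\<^sub>m k) *\<^sub>v (M *\<^sub>v v)"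
    using M v by (intro assoc_mult_mat_vec[of _ n n _ n]) auto
  also have "\<dots> = l \<cdot>\<^sub>v ((M ^\<^sub>m k) *\<^sub>v v)"
    unfolding eig by (rule mult_mat_vec[OF pow_carrier_mat[OF M] v])
  also have "\<dots> = (l * l ^ k) \<cdot>\<^sub>v v" by (simp add: Suc.IH smult_smult_assoc)
  finally show ?case by simp
qed (use M v in simp)

text \<open>Among the infinitely many iterates of \<open>f\<close> two agree on the finite set, and injectivity cancels the
smaller one.\<close>

lemma finite_inj_funpow_eq_id:
  assumes fin: "finite S" and maps: "f ` S \<subseteq> S" and inj: "inj_on f S"
  obtains k where "0 < k" "\<And>x. x \<in> S \<Longrightarrow> (f ^^ k) x = x"
proof -
  have mem: "(f ^^ i) x \<in> S" if "x \<in> S" for i x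
    using that maps by (induction i) auto
  have injk: "inj_on (f ^^ i) S" for i
  proof (induction i)
    case (Suc i)
    show ?case
    proof (rule inj_onI)
      fix x y assume xy: "x \<in> S" "y \<in> S" "(f ^^ Suc i) x = (f ^^ Suc i) y"
      hence "(f ^^ i) x = (f ^^ i) y" using inj mem by (auto dest: inj_onD)
      thus "x = y" using Suc.IH xy by (auto dest: inj_onD)
    qed
  qed simp
  have "range (\<lambda>i. restrict (f ^^ i) S) \<subseteq> S \<rightarrow>\<^sub>E S" using mem by auto
  hence "finite (range (\<lambda>i. restrict (f ^^ i) S))"
    using finite_PiE[OF fin, of "\<lambda>_. S"] fin finite_subset by blast
  hence "\<not> inj (\<lambda>i. restrict (f ^^ i) S)" using finite_imageD infinite_UNIV_nat by blast
  then obtain i j where "i < j" and eq: "restrict (f ^^ i) S = restrict (f ^^ j) S"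
    unfolding inj_def by (metis linorder_neqE_nat)
  define k where "k = j - i"
  have "(f ^^ k) x = x" if x: "x \<in> S" for x
  proof -
    have "j = i + k" using \<open>i < j\<close> by (simp add: k_def)
    hence "(f ^^ i) ((f ^^ k) x) = (f ^^ j) x" by (simp add: funpow_add)
    also have "\<dots> = (f ^^ i) x" using fun_cong[OF eq, of x] x by simp
    finally show ?thesis using injk[of i] mem x by (auto dest: inj_onD)
  qed
  thus ?thesis using that[of k] \<open>i < j\<close> by (simp add: k_def)
qed

context odd_irreducible_matrix_group
begin

text \<open>Conjugation by \<open>M\<close> is a permutation of the finite set \<open>\<Gamma>\<close>, so some power of \<open>M\<close> centralizes \<open>\<Gamma>\<close>.
Schur's lemma applies to that power.\<close>

lemma normalizer_power_scalar:
  assumes M: "normalizes n M M' \<Gamma>"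
  obtains k m where "0 < k" "M ^\<^sub>m k = m \<cdot>\<^sub>m 1\<^sub>m n"
proof -
  have Mc: "M \<in> carrier_mat n n" "M' \<in> carrier_mat n n" "M * M' = 1\<^sub>m n" "M' * M = 1\<^sub>m n"
    and MG: "\<And>a. a \<in> \<Gamma> \<Longrightarrow> M * a * M' \<in> \<Gamma>"
    using M by (auto simp: normalizes_def)
  define f where "f x = M * x * M'" for x
  have unconj: "M' * f x * M = x" if "x \<in> \<Gamma>" for x
  proof -
    have "M' * f x * M = (M' * M) * x * (M' * M)"
      unfolding f_def using Mc(1,2) group_carrier[OF that] by (simp add: mat_mult_assoc_dim)
    thus ?thesis unfolding Mc(4) using group_carrier[OF that] by simp
  qed
  have "inj_on f \<Gamma>" by (rule inj_onI) (metis unconj)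
  then obtain k where k: "0 < k" "\<And>x. x \<in> \<Gamma> \<Longrightarrow> (f ^^ k) x = x"
    using finite_inj_funpow_eq_id[OF finite_group, of f] MG by (auto simp: f_def image_subset_iff)
  have mem: "(f ^^ i) x \<in> \<Gamma>" if "x \<in> \<Gamma>" for i x
    using that MG by (induction i) (auto simp: f_def)
  have step: "M ^\<^sub>m i * x = (f ^^ i) x * M ^\<^sub>m i" if "x \<in> \<Gamma>" for i x
    using that
  proof (induction i arbitrary: x)
    case 0
    thus ?case using Mc group_carrier[of x] by simp
  next
    case (Suc i)
    note xc = group_carrier[OF Suc.prems]
    have fx: "f x \<in> \<Gamma>" using MG Suc.prems by (simp add: f_def)
    have Mi: "M ^\<^sub>m i \<in> carrier_mat n n" using Mc by simp
    have "f x * M = M * x * (M' * M)" unfolding f_def using Mc(1,2) xc by (simp add: mat_mult_assoc_dim)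
    hence Mx: "M * x = f x * M" unfolding Mc(4) using Mc(1) xc by simp
    have "M ^\<^sub>m i * M * x = M ^\<^sub>m i * (M * x)" using Mi Mc(1) xc by (intro assoc_mult_mat) auto
    also have "\<dots> = (M ^\<^sub>m i * f x) * M"
      unfolding Mx using Mi Mc(1) group_carrier[OF fx] by (intro assoc_mult_mat[symmetric]) auto
    also have "\<dots> = (f ^^ i) (f x) * M ^\<^sub>m i * M" unfolding Suc.IH[OF fx] ..
    also have "\<dots> = (f ^^ Suc i) x * (M ^\<^sub>m i * M)"
      using Mi Mc(1) group_carrier[OF mem[OF fx, of i]] by (simp add: funpow_swap1 assoc_mult_mat[of _ n n _ n _ n])
    finally show ?case by simp
  qed
  have "M ^\<^sub>m k * g = g * M ^\<^sub>m k" if "g \<in> \<Gamma>" for g using step[OF that, of k] k(2)[OF that] by simp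
  moreover have "M ^\<^sub>m k \<in> carrier_mat n n" using Mc by simp
  ultimately show ?thesis using commutant_scalar that[OF k(1)] by metis
qed

text \<open>If \<open>M ^ k\<close> is the scalar \<open>m\<close>, then \<open>\<bar>m\<bar> ^ n = \<bar>det (M ^ k)\<bar> = 1\<close>, and \<open>l ^ k = m\<close>.\<close>

lemma normalizer_real_eigenvalue:
  assumes M: "normalizes n M M' \<Gamma>" and det: "\<bar>det M\<bar> = 1"
    and v: "v \<in> carrier_vec n" "v \<noteq> 0\<^sub>v n" "M *\<^sub>v v = l \<cdot>\<^sub>v v"
  shows "l = 1 \<or> l = -1"
proof -
  have Mc: "M \<in> carrier_mat n n" using M by (simp add: normalizes_def)
  have n0: "n \<noteq> 0" using odd_n by (cases n) auto
  obtain k m where k: "0 < k" and Mk: "M ^\<^sub>m k = m \<cdot>\<^sub>m 1\<^sub>m n" using normalizer_power_scalar[OF M] by blast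
  have "\<bar>m\<bar> ^ n = \<bar>det (M ^\<^sub>m k)\<bar>" unfolding Mk by (simp add: power_abs)
  also have "\<dots> = 1" using det by (simp add: det_power_mat[OF Mc] power_abs)
  finally have m: "\<bar>m\<bar> = 1" using n0 by (metis abs_ge_zero power_eq_1_iff abs_abs real_norm_def)
  obtain i where i: "i < n" "v $ i \<noteq> 0" using v by (metis carrier_vecD eq_vecI index_zero_vec)
  have "l ^ k \<cdot>\<^sub>v v = m \<cdot>\<^sub>v v"
    using power_mat_eigenvector[OF Mc v(1,3), of k] v(1) unfolding Mk
    by (simp add: smult_mat_mult_vec[of _ n n])
  hence "(l ^ k \<cdot>\<^sub>v v) $ i = (m \<cdot>\<^sub>v v) $ i" by simp
  hence "l ^ k = m" using i v by simp
  hence "\<bar>l ^ k\<bar> = 1" using m by simp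
  hence "\<bar>l\<bar> ^ k = 1" by (simp add: power_abs)
  hence "\<bar>l\<bar> = 1" using k by (metis abs_ge_zero power_eq_1_iff abs_abs real_norm_def neq0_conv)
  thus ?thesis by linarith
qed

text \<open>A real eigenvector \<open>v\<close> of \<open>M = g D\<close> inside an odd-dimensional component where the involution \<open>c\<close>
is \<open>-1\<close> has eigenvalue \<open>1\<close> for \<open>M\<close> or for \<open>c M\<close>.\<close>

theorem coset_has_fixed_vector:
  assumes E: "normal_involutions E" and nontriv: "E \<noteq> {1\<^sub>m n}"
    and D: "normalizes n D D' \<Gamma>" and detD: "\<bar>det D\<bar> = 1" and detG: "\<And>g. g \<in> \<Gamma> \<Longrightarrow> \<bar>det g\<bar> = 1"
  obtains g v where "g \<in> \<Gamma>" "v \<in> carrier_vec n" "v \<noteq> 0\<^sub>v n" "(g * D) *\<^sub>v v = v"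
proof -
  obtain c where c: "c \<in> involution_core" "c \<noteq> 1\<^sub>m n"
    using nontriv E normal_involutionsD(2)[OF E] unfolding involution_core_def by blast
  have cG: "c \<in> \<Gamma>" using c normal_involutionsD(1)[OF normal_involutions_core] by blast
  note cc = group_carrier[OF cG]
  have Dc: "D \<in> carrier_mat n n" "D' \<in> carrier_mat n n" "D * D' = 1\<^sub>m n" "D' * D = 1\<^sub>m n"
    and DG: "\<And>a. a \<in> \<Gamma> \<Longrightarrow> D * a * D' \<in> \<Gamma>" "\<And>a. a \<in> \<Gamma> \<Longrightarrow> D' * a * D \<in> \<Gamma>"
    using D by (auto simp: normalizes_def)
  obtain d B C g where d: "odd d" and BC: "B \<in> carrier_mat n d" "C \<in> carrier_mat d n" "C * B = 1\<^sub>m d"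
    and cP: "c * (B * C) = (-1) \<cdot>\<^sub>m (B * C)"
    and g: "g \<in> \<Gamma>" and comm: "(g * D) * (B * C) = B * C * (g * D)"
    using odd_rank_isotypic_component[OF normal_involutions_core c] normalizes_core[OF D] by metis
  define M where "M = g * D"
  note gc = group_carrier[OF g]
  obtain g' where g': "g' \<in> \<Gamma>" "g * g' = 1\<^sub>m n" "g' * g = 1\<^sub>m n" using inverse_in_group[OF g] by blast
  note g'c = group_carrier[OF g'(1)]
  have Mc: "M \<in> carrier_mat n n" using gc Dc by (simp add: M_def)
  have M: "normalizes n M (D' * g') \<Gamma>"
    unfolding normalizes_def
  proof (intro conjI ballI)
    have "M * (D' * g') = g * (D * D') * g'" using gc g'c Dc(1,2) by (simp add: M_def mat_mult_assoc_dim)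
    thus "M * (D' * g') = 1\<^sub>m n" unfolding Dc(3) using gc g' by simp
    have "D' * g' * M = D' * (g' * g) * D" using gc g'c Dc(1,2) by (simp add: M_def mat_mult_assoc_dim)
    thus "D' * g' * M = 1\<^sub>m n" unfolding g'(3) using Dc by simp
  next
    fix a assume a: "a \<in> \<Gamma>"
    note ac = group_carrier[OF a]
    have "M * a * (D' * g') = g * (D * a * D') * g'"
      using gc g'c Dc(1,2) ac by (simp add: M_def mat_mult_assoc_dim)
    thus "M * a * (D' * g') \<in> \<Gamma>" using DG(1)[OF a] g g'(1) mult_in_group by simp
    have "D' * g' * a * M = D' * (g' * a * g) * D"
      using gc g'c Dc(1,2) ac by (simp add: M_def mat_mult_assoc_dim)
    thus "D' * g' * a * M \<in> \<Gamma>" using DG(2)[of "g' * a * g"] a g g'(1) mult_in_group by simp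
  qed (use Mc Dc g'c in auto)
  have detM: "\<bar>det M\<bar> = 1" using detD detG[OF g] det_mult[OF gc Dc(1)] by (simp add: M_def abs_mult)
  have "C * M * B \<in> carrier_mat d d" using BC Mc by simp
  then obtain u l where u: "u \<in> carrier_vec d" "u \<noteq> 0\<^sub>v d" "(C * M * B) *\<^sub>v u = l \<cdot>\<^sub>v u"
    using odd_dim_real_eigenvector d by blast
  define v where "v = B *\<^sub>v u"
  have v: "v \<in> carrier_vec n" using BC u by (simp add: v_def)
  have "C *\<^sub>v v = (C * B) *\<^sub>v u"
    unfolding v_def using BC(1,2) u by (intro assoc_mult_mat_vec[symmetric]) auto
  hence "C *\<^sub>v v = u" unfolding BC(3) using u by simp
  hence v0: "v \<noteq> 0\<^sub>v n" using u BC(2) by (auto intro!: eq_vecI)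
  have "M * B = M * (B * C) * B"
  proof -
    have "M * (B * C) * B = M * B * (C * B)" using BC(1,2) Mc by (simp add: mat_mult_assoc_dim)
    thus ?thesis unfolding BC(3) using BC(1) Mc by simp
  qed
  also have "\<dots> = B * (C * M * B)"
    unfolding M_def comm using BC(1,2) gc Dc(1) by (simp add: mat_mult_assoc_dim)
  finally have MB: "M * B = B * (C * M * B)" .
  have "M *\<^sub>v v = (M * B) *\<^sub>v u"
    unfolding v_def using BC(1,2) u Mc by (intro assoc_mult_mat_vec[symmetric]) auto
  also have "\<dots> = B *\<^sub>v ((C * M * B) *\<^sub>v u)"
    unfolding MB using BC(1,2) u Mc by (intro assoc_mult_mat_vec[of _ n d _ d]) auto
  also have "\<dots> = l \<cdot>\<^sub>v v" unfolding u(3) v_def using BC(1) u(1) by (simp add: mult_mat_vec[of _ n d])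
  finally have Mv: "M *\<^sub>v v = l \<cdot>\<^sub>v v" .
  have cB: "c * B = (-1) \<cdot>\<^sub>m B"
  proof -
    have "c * (B * C) * B = c * B * (C * B)" using BC(1,2) cc by (simp add: mat_mult_assoc_dim)
    hence "c * B = c * (B * C) * B" unfolding BC(3) using BC(1) cc by simp
    also have "\<dots> = (-1) \<cdot>\<^sub>m (B * (C * B))"
      unfolding cP using BC(1,2)
      by (simp add: mult_smult_assoc_mat[of _ n n _ d] mat_mult_assoc_dim)
    finally show ?thesis unfolding BC(3) using BC(1) by simp
  qed
  have "c *\<^sub>v v = (c * B) *\<^sub>v u"
    unfolding v_def using BC(1) u cc by (intro assoc_mult_mat_vec[symmetric]) auto
  also have "\<dots> = (-1) \<cdot>\<^sub>v v" unfolding cB v_def by (rule smult_mat_mult_vec[OF BC(1) u(1)])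
  finally have cv: "c *\<^sub>v v = (-1) \<cdot>\<^sub>v v" .
  from normalizer_real_eigenvalue[OF M detM v v0 Mv] show ?thesis
  proof
    assume "l = 1"
    thus ?thesis using that[OF g v v0] Mv unfolding M_def by simp
  next
    assume l: "l = -1"
    have "(c * g * D) *\<^sub>v v = (c * M) *\<^sub>v v" using cc gc Dc(1) by (simp add: M_def mat_mult_assoc_dim)
    also have "\<dots> = c *\<^sub>v (M *\<^sub>v v)" using cc Mc v by (intro assoc_mult_mat_vec) auto
    also have "\<dots> = v" unfolding Mv l using cc v cv by (simp add: mult_mat_vec[of _ n n] smult_smult_assoc)
    finally show ?thesis using that[OF mult_in_group[OF cG g] v v0] by blast
  qed
qed

end

section \<open>Integral representations\<close>

lemma GL_int_carrier:
  "carrier (GL_int n) = {M \<in> carrier_mat n n. \<exists>M'\<in>carrier_mat n n. M' * M = 1\<^sub>m n \<and> M * M' = 1\<^sub>m n}"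
  by (auto simp: GL_int_def units_of_def Units_def ring_mat_simps)

lemma GL_int_simps [simp]:
  "monoid.mult (GL_int n) = (*)" "monoid.one (GL_int n) = 1\<^sub>m n"
  by (simp_all add: GL_int_def units_of_def ring_mat_simps)

lemma group_GL_int: "group (GL_int n)"
  unfolding GL_int_def by (intro monoid.units_group ring.is_monoid ring_mat)

lemma real_mat_mult:
  "A \<in> carrier_mat n n \<Longrightarrow> B \<in> carrier_mat n n \<Longrightarrow> real_mat (A * B) = real_mat A * real_mat B"
  by (rule of_int_hom.mat_hom_mult)

lemma mat_trace_real_mat:
  "M \<in> carrier_mat n n \<Longrightarrow> mat_trace (real_mat M) = of_int (mat_trace M)"
  by (simp add: mat_trace_def)

lemma det_GL_int:
  assumes "M \<in> carrier (GL_int n)" shows "\<bar>det (real_mat M)\<bar> = 1"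
proof -
  obtain M' where M: "M \<in> carrier_mat n n" "M' \<in> carrier_mat n n" "M * M' = 1\<^sub>m n"
    using assms by (auto simp: GL_int_carrier)
  have "det M * det M' = 1" using det_mult[OF M(1,2)] M(3) by simp
  hence "\<bar>det M\<bar> = 1" using abs_zmult_eq_1 by (metis abs_one)
  hence "\<bar>real_of_int (det M)\<bar> = 1" by linarith
  thus ?thesis by simp
qed

text \<open>The normalizer is defined through equality of the set \<open>H\<close> with its conjugate, which gives invariance
under conjugation by the inverse of \<open>D\<close> as well.\<close>

lemma normalizer_GL_int_conj:
  assumes D: "D \<in> normalizer (GL_int n) H" and H: "H \<subseteq> carrier (GL_int n)"
  obtains D' where "D \<in> carrier (GL_int n)" "D' \<in> carrier (GL_int n)" "D * D' = 1\<^sub>m n" "D' * D = 1\<^sub>m n"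
    "\<And>h. h \<in> H \<Longrightarrow> D * h * D' \<in> H" "\<And>h. h \<in> H \<Longrightarrow> D' * h * D \<in> H"
proof -
  interpret GL: group "GL_int n" by (rule group_GL_int)
  define D' where "D' = inv\<^bsub>GL_int n\<^esub> D"
  have Dc: "D \<in> carrier (GL_int n)" and eq: "D <#\<^bsub>GL_int n\<^esub> H #>\<^bsub>GL_int n\<^esub> D' = H"
    using D H by (auto simp: normalizer_def stabilizer_def D'_def)
  have D': "D' \<in> carrier (GL_int n)" "D * D' = 1\<^sub>m n" "D' * D = 1\<^sub>m n"
    using GL.inv_closed[OF Dc] GL.r_inv[OF Dc] GL.l_inv[OF Dc] by (simp_all add: D'_def)
  have img: "D <#\<^bsub>GL_int n\<^esub> H #>\<^bsub>GL_int n\<^esub> D' = {D * h * D' | h. h \<in> H}"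
    by (auto simp: l_coset_def r_coset_def)
  have mat: "M \<in> carrier_mat n n" if "M \<in> carrier (GL_int n)" for M
    using that by (simp add: GL_int_carrier)
  have "D' * h * D \<in> H" if h: "h \<in> H" for h
  proof -
    obtain k where k: "k \<in> H" "h = D * k * D'" using h eq img by blast
    have "D' * h * D = (D' * D) * k * (D' * D)"
      unfolding k(2) using mat[OF Dc] mat[OF D'(1)] mat[of k] k(1) H by (auto simp: mat_mult_assoc_dim)
    hence "D' * h * D = k" unfolding D'(3) using mat[of k] k(1) H by auto
    thus ?thesis using k(1) by simp
  qed
  moreover have "D * h * D' \<in> H" if "h \<in> H" for h using that eq img by blast
  ultimately show ?thesis using that[OF Dc D'] by blast
qed

lemma subspace_module_vecI:
  fixes W :: "real vec set"
  assumes "W \<subseteq> carrier_vec n" "0\<^sub>v n \<in> W" "\<And>u w. u \<in> W \<Longrightarrow> w \<in> W \<Longrightarrow> u + w \<in> W"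
    "\<And>c w. w \<in> W \<Longrightarrow> c \<cdot>\<^sub>v w \<in> W"
  shows "VectorSpace.subspace class_ring W (module_vec TYPE(real) n)"
proof -
  have vs: "vectorspace class_ring (module_vec TYPE(real) n)" by (rule vec_vs)
  thus ?thesis
    unfolding VectorSpace.subspace_def submodule_def using assms
    by (auto simp: module_vec_simps vectorspace_def)
qed

theorem theorem1:
  fixes G :: "('g, 'x) monoid_scheme" and A :: "'g set"
    and n :: nat and \<rho> :: "'g \<Rightarrow> int mat"
  assumes "group G" and "finite (carrier G)"
    and "A \<lhd> G" and "comm_group (G\<lparr>carrier := A\<rparr>)" and "A \<noteq> {\<one>\<^bsub>G\<^esub>}"
    and "\<rho> \<in> hom G (GL_int n)" and "inj_on \<rho> (carrier G)"
    and "R_irreducible G n \<rho>"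
    and "odd n"
  shows "\<forall>D \<in> normalizer (GL_int n) (\<rho> ` carrier G).
           \<exists>g \<in> carrier G. eigenvalue (real_mat (\<rho> g * D)) 1"
proof
  fix D assume D: "D \<in> normalizer (GL_int n) (\<rho> ` carrier G)"
  interpret G: group G by fact
  interpret A: normal A G by fact
  interpret A_comm: comm_group "G\<lparr>carrier := A\<rparr>" by fact
  interpret \<rho>: group_hom G "GL_int n" \<rho>
    using assms by (auto intro!: group_hom.intro group_GL_int simp: group_hom_axioms_def)
  define \<sigma> where "\<sigma> g = real_mat (\<rho> g)" for g
  have \<rho>c: "\<rho> g \<in> carrier_mat n n" if "g \<in> carrier G" for g
    using \<rho>.hom_closed[OF that] by (simp add: GL_int_carrier)
  have \<sigma>c: "\<sigma> g \<in> carrier_mat n n" if "g \<in> carrier G" for g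
    using \<rho>c[OF that] by (simp add: \<sigma>_def)
  have \<sigma>_mult: "\<sigma> (g \<otimes>\<^bsub>G\<^esub> h) = \<sigma> g * \<sigma> h" if "g \<in> carrier G" "h \<in> carrier G" for g h
    using \<rho>.hom_mult[OF that] real_mat_mult[OF \<rho>c[OF that(1)] \<rho>c[OF that(2)]] by (simp add: \<sigma>_def)
  have \<sigma>_one: "\<sigma> \<one>\<^bsub>G\<^esub> = 1\<^sub>m n"
    using \<rho>.hom_one by (simp add: \<sigma>_def of_int_hom.mat_hom_one)
  have \<sigma>_inj: "g = h" if "g \<in> carrier G" "h \<in> carrier G" "\<sigma> g = \<sigma> h" for g h
    using that of_int_hom.mat_hom_inj inj_onD[OF assms(7)] unfolding \<sigma>_def by blast
  have \<sigma>_inv: "\<sigma> g * \<sigma> (inv\<^bsub>G\<^esub> g) = 1\<^sub>m n" "\<sigma> (inv\<^bsub>G\<^esub> g) * \<sigma> g = 1\<^sub>m n" if "g \<in> carrier G" for g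
    using that by (simp_all flip: \<sigma>_mult add: \<sigma>_one)
  have uniq_inv: "\<sigma> h = \<sigma> (inv\<^bsub>G\<^esub> g)" if "g \<in> carrier G" "h \<in> carrier G" "\<sigma> g * \<sigma> h = 1\<^sub>m n" for g h
  proof -
    have "g \<otimes>\<^bsub>G\<^esub> h = \<one>\<^bsub>G\<^esub>" using that by (intro \<sigma>_inj) (simp_all add: \<sigma>_mult \<sigma>_one)
    thus ?thesis using G.inv_equality[of g h] that by (metis G.inv_inv)
  qed
  define \<Gamma> where "\<Gamma> = \<sigma> ` carrier G"
  interpret odd_irreducible_matrix_group n \<Gamma>
  proof
    fix W :: "real vec set"
    assume W: "W \<subseteq> carrier_vec n" "0\<^sub>v n \<in> W" "\<And>u w. u \<in> W \<Longrightarrow> w \<in> W \<Longrightarrow> u + w \<in> W"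
      "\<And>c w. w \<in> W \<Longrightarrow> c \<cdot>\<^sub>v w \<in> W" and inv: "\<And>g w. g \<in> \<Gamma> \<Longrightarrow> w \<in> W \<Longrightarrow> g *\<^sub>v w \<in> W"
    have "invariant_subspace G n (\<lambda>g. real_mat (\<rho> g)) W"
      unfolding invariant_subspace_def
    proof (intro conjI ballI)
      show "VectorSpace.subspace class_ring W (module_vec TYPE(real) n)"
        using W by (rule subspace_module_vecI)
      fix g w assume "g \<in> carrier G" "w \<in> W"
      thus "real_mat (\<rho> g) *\<^sub>v w \<in> W" using inv[of "\<sigma> g" w] by (simp add: \<Gamma>_def \<sigma>_def)
    qed
    thus "W = {0\<^sub>v n} \<or> W = carrier_vec n"
      using assms(8) by (simp add: R_irreducible_def irreducible_rep_def)
  next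
    fix g assume "g \<in> \<Gamma>"
    thus "\<exists>h\<in>\<Gamma>. g * h = 1\<^sub>m n \<and> h * g = 1\<^sub>m n" using \<sigma>_inv unfolding \<Gamma>_def by blast
  next
    fix g h assume "g \<in> \<Gamma>" "h \<in> \<Gamma>"
    then obtain x y where xy: "x \<in> carrier G" "y \<in> carrier G" "g = \<sigma> x" "h = \<sigma> y" by (auto simp: \<Gamma>_def)
    show "g * h \<in> \<Gamma>" unfolding xy(3,4) \<sigma>_mult[OF xy(1,2), symmetric] \<Gamma>_def using xy by blast
  next
    show "1\<^sub>m n \<in> \<Gamma>" unfolding \<sigma>_one[symmetric] \<Gamma>_def by blast
  qed (use assms \<sigma>c in \<open>auto simp: \<Gamma>_def\<close>)

  define N where "N = \<sigma> ` A"
  have Asub: "a \<in> carrier G" if "a \<in> A" for a using A.subset that by blast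
  have Nmult: "x * y \<in> N" if "x \<in> N" "y \<in> N" for x y
  proof -
    obtain a b where ab: "a \<in> A" "b \<in> A" "x = \<sigma> a" "y = \<sigma> b" using \<open>x \<in> N\<close> \<open>y \<in> N\<close> unfolding N_def by blast
    have "x * y = \<sigma> (a \<otimes>\<^bsub>G\<^esub> b)" unfolding ab(3,4) using ab(1,2) Asub by (simp add: \<sigma>_mult)
    thus ?thesis unfolding N_def using A.m_closed[OF ab(1,2)] by blast
  qed
  have Ncomm: "x * y = y * x" if "x \<in> N" "y \<in> N" for x y
  proof -
    obtain a b where ab: "a \<in> A" "b \<in> A" "x = \<sigma> a" "y = \<sigma> b" using \<open>x \<in> N\<close> \<open>y \<in> N\<close> unfolding N_def by blast
    have "a \<otimes>\<^bsub>G\<^esub> b = b \<otimes>\<^bsub>G\<^esub> a" using A_comm.m_comm[of a b] ab by simp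
    thus ?thesis unfolding ab(3,4) using ab(1,2) Asub by (simp flip: \<sigma>_mult)
  qed
  have None: "1\<^sub>m n \<in> N" unfolding N_def using \<sigma>_one[symmetric] A.one_closed by (rule image_eqI)
  have Nconj: "g * x * g' \<in> N" if "g \<in> \<Gamma>" "g' \<in> \<Gamma>" "g * g' = 1\<^sub>m n" "x \<in> N" for g g' x
  proof -
    obtain h h' a where h: "h \<in> carrier G" "h' \<in> carrier G" "a \<in> A" "g = \<sigma> h" "g' = \<sigma> h'" "x = \<sigma> a"
      using \<open>g \<in> \<Gamma>\<close> \<open>g' \<in> \<Gamma>\<close> \<open>x \<in> N\<close> unfolding \<Gamma>_def N_def by blast
    have "g' = \<sigma> (inv\<^bsub>G\<^esub> h)" using uniq_inv[OF h(1,2)] that(3) h by simp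
    hence "g * x * g' = \<sigma> (h \<otimes>\<^bsub>G\<^esub> a \<otimes>\<^bsub>G\<^esub> inv\<^bsub>G\<^esub> h)" using h Asub by (simp add: \<sigma>_mult)
    moreover have "h \<otimes>\<^bsub>G\<^esub> a \<otimes>\<^bsub>G\<^esub> inv\<^bsub>G\<^esub> h \<in> A" by (rule A.inv_op_closed2[OF h(1,3)])
    ultimately show ?thesis unfolding N_def by blast
  qed
  have Nsub: "N \<subseteq> \<Gamma>" unfolding N_def \<Gamma>_def using Asub by blast
  have Ninv: "\<exists>y\<in>N. x * y = 1\<^sub>m n \<and> y * x = 1\<^sub>m n" if "x \<in> N" for x
  proof -
    obtain a where a: "a \<in> A" "x = \<sigma> a" using \<open>x \<in> N\<close> unfolding N_def by blast
    show ?thesis unfolding a(2) N_def using \<sigma>_inv[OF Asub[OF a(1)]] A.m_inv_closed[OF a(1)] by blast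
  qed
  have N: "normal_subgroup_set N"
    unfolding normal_subgroup_set_def using Nsub None Nmult Ninv Nconj by blast
  \<comment> \<open>Faithfulness keeps the image of the subgroup non-trivial.\<close>
  have "N \<noteq> {1\<^sub>m n}"
  proof
    assume N1: "N = {1\<^sub>m n}"
    have "a = \<one>\<^bsub>G\<^esub>" if a: "a \<in> A" for a
      using N1 \<sigma>_one a Asub[OF a] unfolding N_def by (intro \<sigma>_inj) auto
    thus False using assms(5) A.one_closed by blast
  qed
  moreover have "mat_trace g \<in> \<int>" if "g \<in> \<Gamma>" for g
    using that mat_trace_real_mat[OF \<rho>c] by (auto simp: \<Gamma>_def \<sigma>_def)
  ultimately obtain c where c: "c \<in> N" "c \<noteq> 1\<^sub>m n" "c * c = 1\<^sub>m n"
    using normal_subgroup_has_involution[OF N] by blast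
  \<comment> \<open>Since \<open>N\<close> is abelian, its elements of order at most two form a subgroup.\<close>
  define E where "E = {a \<in> N. a * a = 1\<^sub>m n}"
  have Nc: "x \<in> carrier_mat n n" if "x \<in> N" for x using that Nsub group_carrier by blast
  have "normal_involutions E"
    unfolding normal_involutions_def
  proof (intro conjI ballI impI)
    show "E \<subseteq> \<Gamma>" "1\<^sub>m n \<in> E" using Nsub None by (auto simp: E_def)
  next
    fix a b assume "a \<in> E" "b \<in> E"
    hence ab: "a \<in> N" "b \<in> N" "a * a = 1\<^sub>m n" "b * b = 1\<^sub>m n" by (auto simp: E_def)
    note cs = Nc[OF ab(1)] Nc[OF ab(2)]
    have "a * b * (a * b) = a * (b * a) * b" using cs by (simp add: mat_mult_assoc_dim)
    also have "\<dots> = (a * a) * (b * b)" unfolding Ncomm[OF ab(2,1)] using cs by (simp add: mat_mult_assoc_dim)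
    also have "\<dots> = 1\<^sub>m n" unfolding ab by simp
    finally show "a * b \<in> E" using Nmult[OF ab(1,2)] by (simp add: E_def)
  next
    fix a assume "a \<in> E" thus "a * a = 1\<^sub>m n" by (simp add: E_def)
  next
    fix g g' a assume g: "g \<in> \<Gamma>" "g' \<in> \<Gamma>" "g * g' = 1\<^sub>m n" and "a \<in> E"
    hence a: "a \<in> N" "a * a = 1\<^sub>m n" by (auto simp: E_def)
    note cs = group_carrier[OF g(1)] group_carrier[OF g(2)] Nc[OF a(1)]
    have g'g: "g' * g = 1\<^sub>m n" by (rule mat_mult_left_right_inverse[OF cs(1,2) g(3)])
    have "(g * a * g') * (g * a * g') = g * a * (g' * g) * (a * g')" using cs by (simp add: mat_mult_assoc_dim)
    also have "\<dots> = g * (a * a) * g'" unfolding g'g using cs by (simp add: mat_mult_assoc_dim)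
    also have "\<dots> = 1\<^sub>m n" unfolding a(2) using cs g(3) by simp
    finally show "g * a * g' \<in> E" using Nconj[OF g a(1)] by (simp add: E_def)
  qed
  moreover have "E \<noteq> {1\<^sub>m n}" using c by (auto simp: E_def)
  moreover have "\<rho> ` carrier G \<subseteq> carrier (GL_int n)" using \<rho>.hom_closed by blast
  then obtain D' where D': "D \<in> carrier (GL_int n)" "D' \<in> carrier (GL_int n)" "D * D' = 1\<^sub>m n" "D' * D = 1\<^sub>m n"
    "\<And>h. h \<in> \<rho> ` carrier G \<Longrightarrow> D * h * D' \<in> \<rho> ` carrier G"
    "\<And>h. h \<in> \<rho> ` carrier G \<Longrightarrow> D' * h * D \<in> \<rho> ` carrier G"
    using normalizer_GL_int_conj[OF D] by metis
  have Dc: "D \<in> carrier_mat n n" "D' \<in> carrier_mat n n" using D'(1,2) by (auto simp: GL_int_carrier)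
  have \<Gamma>_eq: "\<Gamma> = real_mat ` \<rho> ` carrier G" by (auto simp: \<Gamma>_def \<sigma>_def)
  have conj: "real_mat P * a * real_mat Q \<in> \<Gamma>"
    if "\<And>h. h \<in> \<rho> ` carrier G \<Longrightarrow> P * h * Q \<in> \<rho> ` carrier G" "a \<in> \<Gamma>"
      and "P \<in> carrier_mat n n" "Q \<in> carrier_mat n n" for P Q a
  proof -
    obtain g where g: "g \<in> carrier G" "a = real_mat (\<rho> g)" using \<open>a \<in> \<Gamma>\<close> \<Gamma>_eq by blast
    have "real_mat P * a * real_mat Q = real_mat (P * \<rho> g * Q)"
      unfolding g(2) using \<rho>c[OF g(1)] that(3,4) by (simp add: real_mat_mult[of _ n])
    thus ?thesis unfolding \<Gamma>_eq using that(1)[of "\<rho> g"] g(1) by blast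
  qed
  have "normalizes n (real_mat D) (real_mat D') \<Gamma>"
    unfolding normalizes_def
  proof (intro conjI ballI)
    show "real_mat D * real_mat D' = 1\<^sub>m n" "real_mat D' * real_mat D = 1\<^sub>m n"
      using real_mat_mult[OF Dc] real_mat_mult[OF Dc(2,1)] D'(3,4)
      by (simp_all add: of_int_hom.mat_hom_one)
  next
    fix a assume a: "a \<in> \<Gamma>"
    show "real_mat D * a * real_mat D' \<in> \<Gamma>" by (rule conj[OF D'(5) a Dc])
    show "real_mat D' * a * real_mat D \<in> \<Gamma>" by (rule conj[OF D'(6) a Dc(2,1)])
  qed (use Dc in auto)
  moreover have "\<bar>det (real_mat D)\<bar> = 1" by (rule det_GL_int[OF D'(1)])
  moreover have "\<bar>det g\<bar> = 1" if "g \<in> \<Gamma>" for g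
    using that det_GL_int[OF \<rho>.hom_closed] unfolding \<Gamma>_eq by blast
  ultimately obtain \<gamma> v where \<gamma>: "\<gamma> \<in> \<Gamma>" and v: "v \<in> carrier_vec n" "v \<noteq> 0\<^sub>v n" "(\<gamma> * real_mat D) *\<^sub>v v = v"
    using coset_has_fixed_vector by metis
  obtain g where g: "g \<in> carrier G" "\<gamma> = real_mat (\<rho> g)" using \<gamma> \<Gamma>_eq by blast
  have "real_mat (\<rho> g * D) = \<gamma> * real_mat D" using real_mat_mult[OF \<rho>c[OF g(1)] Dc(1)] g(2) by simp
  hence "eigenvector (real_mat (\<rho> g * D)) v 1"
    using v group_carrier[OF \<gamma>] by (simp add: eigenvector_def)
  thus "\<exists>g \<in> carrier G. eigenvalue (real_mat (\<rho> g * D)) 1"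
    using g(1) unfolding eigenvalue_def by blast
qed

end
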